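(* Let $\Lambda$ be the set of irrational $x\in[0,1)$ whose partial quotients $\{a_n(x)\}_{n\ge1}$ are non-decreasing and satisfy $a_n(x)\to\infty$, and for $\alpha\ge0$ let $$E(\alpha):=\Big\{x\in\Lambda:\liminf_{n\to\infty}\frac{\log a_n(x)}{\log n}=\alpha\Big\}.$$ Then $\dim_{\rm H}E(\alpha)=0$ for $0\le\alpha<1$ and $\dim_{\rm H}E(\alpha)=\frac{\alpha-1}{2\alpha}$ for $\alpha\ge1$.
   Context: For irrational $x\in[0,1)$, $x=[a_1(x),a_2(x),\dots]$ denotes its continued fraction expansion $x=\cfrac{1}{a_1(x)+\cfrac{1}{a_2(x)+\cdots}}$ with positive integer partial quotients $a_n(x)$. $\dim_{\rm H}$ denotes Hausdorff dimension. *)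

theory Defs
  imports "HOL-Analysis.Analysis"
begin

section \<open>Hausdorff measure and Hausdorff dimension\<close>

text \<open>The weight of a covering set is its diameter to the power \<open>s\<close>, with the usual
  convention that for \<open>s = 0\<close> every nonempty set has weight 1 (note that
  \<open>0 powr 0 = 0\<close> in HOL) and that the empty set always has weight 0.\<close>

definition hausdorff_weight :: "real \<Rightarrow> 'a::metric_space set \<Rightarrow> ennreal" where
  "hausdorff_weight s U =
     (if U = {} then 0 else if s = 0 then 1 else ennreal (diameter U powr s))"

text \<open>Boundedness is required explicitly because \<^const>\<open>diameter\<close> is unspecified
  on unbounded sets. Finite covers are included, as the sets \<open>U i\<close> may be empty.\<close>

definition hausdorff_premeasure :: "real \<Rightarrow> real \<Rightarrow> 'a::metric_space set \<Rightarrow> ennreal" where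
  "hausdorff_premeasure s \<delta> A =
     (INF U \<in> {U :: nat \<Rightarrow> 'a set.
                 A \<subseteq> (\<Union>i. U i) \<and> (\<forall>i. bounded (U i) \<and> diameter (U i) \<le> \<delta>)}.
        \<Sum>i. hausdorff_weight s (U i))"

definition hausdorff_measure :: "real \<Rightarrow> 'a::metric_space set \<Rightarrow> ennreal" where
  "hausdorff_measure s A = (SUP \<delta> \<in> {0<..}. hausdorff_premeasure s \<delta> A)"

text \<open>The infimum is taken in \<^typ>\<open>ereal\<close>, so that it is \<open>\<infinity>\<close> if no \<open>s\<close> qualifies.\<close>

definition hausdorff_dim :: "'a::metric_space set \<Rightarrow> ereal" where
  "hausdorff_dim A = Inf (ereal ` {s. 0 \<le> s \<and> hausdorff_measure s A = 0})"

section \<open>Continued fractions\<close>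

text \<open>\<open>cf_value [a\<^sub>1, \<dots>, a\<^sub>n] = 1 / (a\<^sub>1 + 1 / (a\<^sub>2 + \<dots> + 1 / a\<^sub>n))\<close>\<close>

fun cf_value :: "nat list \<Rightarrow> real" where
  "cf_value [] = 0"
| "cf_value (a # as) = 1 / (real a + cf_value as)"

text \<open>Partial quotients are indexed from 1. The entry at index 0 is the integer part of the
  number, which is 0 for elements of the unit interval; fixing it makes the sequence unique.\<close>

definition is_cf_expansion :: "(nat \<Rightarrow> nat) \<Rightarrow> real \<Rightarrow> bool" where
  "is_cf_expansion a x \<longleftrightarrow>
     a 0 = 0 \<and> (\<forall>n\<ge>1. a n \<ge> 1) \<and> (\<lambda>n. cf_value (map a [1..<Suc n])) \<longlonglongrightarrow> x"

text \<open>The sequence of partial quotients of an irrational \<open>x\<close> in the unit interval; it is well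
  defined by \<open>ex1_cf_expansion\<close> below.\<close>

definition partial_quotients :: "real \<Rightarrow> nat \<Rightarrow> nat" where
  "partial_quotients x = (THE a. is_cf_expansion a x)"

section \<open>The sets under consideration\<close>

definition Lambda_set :: "real set" where
  "Lambda_set = {x. x \<in> {0..<1} \<and> x \<notin> \<rat> \<and>
     mono_on {1..} (partial_quotients x) \<and>
     filterlim (partial_quotients x) at_top sequentially}"

text \<open>The lower limit is taken in \<^typ>\<open>ereal\<close> since it may be infinite.\<close>

definition E_set :: "real \<Rightarrow> real set" where
  "E_set \<alpha> = {x \<in> Lambda_set.
     liminf (\<lambda>n. ereal (ln (real (partial_quotients x n)) / ln (real n))) = ereal \<alpha>}"

section \<open>Existence and uniqueness of the continued fraction expansion\<close>

fun cf_tail :: "nat list \<Rightarrow> real \<Rightarrow> real" where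
  "cf_tail [] y = y"
| "cf_tail (a # as) y = 1 / (real a + cf_tail as y)"

lemma cf_value_eq_tail: "cf_value as = cf_tail as 0"
  by (induction as) auto

lemma cf_tail_range:
  assumes "\<forall>a\<in>set as. a \<ge> 1" "0 \<le> y" "y \<le> 1"
  shows "0 \<le> cf_tail as y \<and> cf_tail as y \<le> 1"
  using assms by (induction as) (auto simp: divide_simps)

lemma cf_two_step:
  fixes y z :: real
  assumes "a \<ge> 1" "b \<ge> 1" "0 \<le> y" "0 \<le> z"
  shows "\<bar>1 / (real a + 1 / (real b + y)) - 1 / (real a + 1 / (real b + z))\<bar> \<le> \<bar>y - z\<bar> / 2"
proof -
  define p q where "p = real a * (real b + y) + 1" and "q = real a * (real b + z) + 1"
  have b: "real b + y \<ge> 1" "real b + z \<ge> 1" "real a \<ge> 1" using assms by auto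
  have "real a * (real b + y) \<ge> 1 * 1" "real a * (real b + z) \<ge> 1 * 1"
    using b by (intro mult_mono; simp)+
  then have pq: "p \<ge> 2" "q \<ge> 2" by (auto simp: p_def q_def)
  have e: "1 / (real a + 1 / (real b + y)) = (real b + y) / p"
    "1 / (real a + 1 / (real b + z)) = (real b + z) / q"
    using b pq by (auto simp: p_def q_def field_simps)
  have num: "(real b + y) * q - (real b + z) * p = y - z"
    by (simp add: p_def q_def algebra_simps)
  have "(real b + y) / p - (real b + z) / q = (y - z) / (p * q)"
    using pq num by (simp add: diff_frac_eq)
  moreover have "p * q \<ge> 2 * 1" using pq by (intro mult_mono) auto
  ultimately have "\<bar>(real b + y) / p - (real b + z) / q\<bar> = \<bar>y - z\<bar> / (p * q)"
    using pq by (simp add: abs_mult)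
  also have "\<dots> \<le> \<bar>y - z\<bar> / 2"
    using \<open>p * q \<ge> 2 * 1\<close> by (intro divide_left_mono) auto
  finally show ?thesis by (simp add: e)
qed

lemma cf_tail_diff:
  assumes "\<forall>a\<in>set as. a \<ge> 1" "0 \<le> y" "y \<le> 1" "0 \<le> z" "z \<le> 1"
  shows "\<bar>cf_tail as y - cf_tail as z\<bar> \<le> (1/2) ^ (length as div 2)"
  using assms(1)
proof (induction as rule: induct_list012)
  case 1
  then show ?case using assms by auto
next
  case (2 a)
  have "0 \<le> cf_tail [a] y \<and> cf_tail [a] y \<le> 1" "0 \<le> cf_tail [a] z \<and> cf_tail [a] z \<le> 1"
    using 2 assms by (intro cf_tail_range; simp)+
  then have "\<bar>cf_tail [a] y - cf_tail [a] z\<bar> \<le> 1" by linarith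
  then show ?case by simp
next
  case (3 a b as)
  have "0 \<le> cf_tail as y" "0 \<le> cf_tail as z" using 3 assms cf_tail_range by auto
  then have "\<bar>cf_tail (a # b # as) y - cf_tail (a # b # as) z\<bar>
      \<le> \<bar>cf_tail as y - cf_tail as z\<bar> / 2"
    using 3 cf_two_step[of a b] by simp
  also have "\<dots> \<le> (1/2) ^ (length as div 2) / 2" using 3 by simp
  finally show ?case by simp
qed

definition gauss_map :: "real \<Rightarrow> real" where
  "gauss_map x = frac (1 / x)"

lemma gauss_map_irrational:
  assumes "x \<notin> \<rat>" shows "gauss_map x \<notin> \<rat>" "0 < gauss_map x" "gauss_map x < 1"
proof -
  have "1 / x \<notin> \<rat>" using assms Rats_inverse[of "1/x"] by auto
  then have *: "frac (1 / x) \<notin> \<rat>"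
    unfolding frac_def by (metis Rats_add Rats_of_int diff_add_cancel)
  then show "gauss_map x \<notin> \<rat>" by (simp add: gauss_map_def)
  have "frac (1 / x) \<noteq> 0" using * Rats_0 by metis
  then show "0 < gauss_map x" "gauss_map x < 1"
    using frac_ge_0[of "1/x"] frac_lt_1[of "1/x"] by (auto simp: gauss_map_def)
qed

lemma gauss_orbit:
  assumes "x \<notin> \<rat>" "0 < x" "x < 1"
  shows "(gauss_map ^^ n) x \<notin> \<rat> \<and> 0 < (gauss_map ^^ n) x \<and> (gauss_map ^^ n) x < 1"
  using assms by (induction n) (auto simp: gauss_map_irrational)

definition gauss_digit :: "real \<Rightarrow> nat \<Rightarrow> nat" where
  "gauss_digit x n = (if n = 0 then 0 else nat \<lfloor>1 / (gauss_map ^^ (n - 1)) x\<rfloor>)"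

lemma floor_recip:
  fixes x :: real
  assumes "0 < x" "x < 1"
  shows "nat \<lfloor>1 / x\<rfloor> \<ge> 1" "x = 1 / (real (nat \<lfloor>1 / x\<rfloor>) + gauss_map x)"
proof -
  have "1 / x \<ge> 1" using assms by simp
  then have f: "\<lfloor>1 / x\<rfloor> \<ge> 1" by (simp add: le_floor_iff)
  then show "nat \<lfloor>1 / x\<rfloor> \<ge> 1" by linarith
  have "real (nat \<lfloor>1 / x\<rfloor>) + gauss_map x = 1 / x"
    using f assms by (simp add: gauss_map_def frac_def)
  then show "x = 1 / (real (nat \<lfloor>1 / x\<rfloor>) + gauss_map x)" by simp
qed

lemma cf_tail_append: "cf_tail (as @ bs) y = cf_tail as (cf_tail bs y)"
  by (induction as) auto

lemma is_cf_expansion_gauss_digit: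
  assumes "x \<notin> \<rat>" "0 < x" "x < 1"
  shows "is_cf_expansion (gauss_digit x) x"
proof -
  let ?L = "\<lambda>n. map (gauss_digit x) [1..<Suc n]"
  have pos: "gauss_digit x n \<ge> 1" if "n \<ge> 1" for n
    using floor_recip(1)[of "(gauss_map ^^ (n - 1)) x"] gauss_orbit[OF assms, of "n - 1"] that
    by (auto simp: gauss_digit_def)
  have x: "x = cf_tail (?L n) ((gauss_map ^^ n) x)" for n
  proof (induction n)
    case (Suc n)
    have "(gauss_map ^^ n) x = cf_tail [gauss_digit x (Suc n)] ((gauss_map ^^ Suc n) x)"
      using floor_recip(2)[of "(gauss_map ^^ n) x"] gauss_orbit[OF assms, of n]
      by (simp add: gauss_digit_def)
    then have "cf_tail (?L n) ((gauss_map ^^ n) x)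
        = cf_tail (?L n @ [gauss_digit x (Suc n)]) ((gauss_map ^^ Suc n) x)"
      by (simp only: cf_tail_append)
    then show ?case using Suc by simp
  qed simp
  have bound: "\<bar>cf_value (?L n) - x\<bar> \<le> (1/2) ^ (n div 2)" for n
  proof -
    have "\<bar>cf_tail (?L n) 0 - cf_tail (?L n) ((gauss_map ^^ n) x)\<bar>
        \<le> (1/2) ^ (length (?L n) div 2)"
      using pos gauss_orbit[OF assms, of n] by (intro cf_tail_diff) auto
    then show ?thesis using x[of n] by (simp add: cf_value_eq_tail del: upt_Suc)
  qed
  have "filterlim (\<lambda>n::nat. n div 2) sequentially sequentially"
    unfolding filterlim_at_top
  proof
    fix Z :: nat
    show "\<forall>\<^sub>F n in sequentially. Z \<le> n div 2"
      using eventually_ge_at_top[of "2 * Z"] by eventually_elim linarith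
  qed
  then have "(\<lambda>n. (1/2::real) ^ (n div 2)) \<longlonglongrightarrow> 0"
    by (rule filterlim_compose[OF LIMSEQ_power_zero, rotated]) simp
  then have "(\<lambda>n. cf_value (?L n) - x) \<longlonglongrightarrow> 0"
    by (rule Lim_null_comparison[rotated]) (use bound in auto)
  then have "(\<lambda>n. cf_value (?L n)) \<longlonglongrightarrow> x" using LIM_zero_iff by blast
  then show ?thesis using pos by (auto simp: is_cf_expansion_def gauss_digit_def)
qed

lemma cf_shift:
  assumes x: "x \<notin> \<rat>" and pos: "\<forall>n. b n \<ge> 1"
    and lim: "(\<lambda>n. cf_value (map b [0..<n])) \<longlonglongrightarrow> x"
  shows "b 0 = nat \<lfloor>1 / x\<rfloor>"
    and "(\<lambda>n. cf_value (map (\<lambda>k. b (Suc k)) [0..<n])) \<longlonglongrightarrow> gauss_map x"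
proof -
  let ?y = "\<lambda>n. cf_value (map (\<lambda>k. b (Suc k)) [0..<n])"
  have eq: "cf_value (map b [0..<Suc n]) = 1 / (real (b 0) + ?y n)" for n
    by (subst map_upt_Suc) simp
  have r: "0 \<le> ?y n \<and> ?y n \<le> 1" for n
    unfolding cf_value_eq_tail using pos by (intro cf_tail_range) auto
  have x0: "x \<noteq> 0" using x by auto
  have "(\<lambda>n. 1 / (real (b 0) + ?y n)) \<longlonglongrightarrow> x"
    using LIMSEQ_Suc[OF lim] by (simp only: eq)
  then have "(\<lambda>n. 1 / (1 / (real (b 0) + ?y n)) - real (b 0)) \<longlonglongrightarrow> 1 / x - real (b 0)"
    using x0 by (intro tendsto_intros) auto
  then have ylim: "?y \<longlonglongrightarrow> 1 / x - real (b 0)" by simp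
  have ge: "0 \<le> 1 / x - real (b 0)"
    by (rule LIMSEQ_le_const[OF ylim]) (use r in blast)
  have le: "1 / x - real (b 0) \<le> 1"
    by (rule LIMSEQ_le_const2[OF ylim]) (use r in blast)
  have "1 / x - real (b 0) \<noteq> 1"
  proof
    assume "1 / x - real (b 0) = 1"
    then have "x = 1 / (real (b 0) + 1)" using x0 by (simp add: field_simps)
    also have "\<dots> \<in> \<rat>" by (intro Rats_divide Rats_add Rats_of_nat Rats_1)
    finally show False using x by simp
  qed
  then have fl: "\<lfloor>1 / x\<rfloor> = int (b 0)" using ge le by (intro floor_unique) auto
  then show "b 0 = nat \<lfloor>1 / x\<rfloor>" by simp
  have "gauss_map x = 1 / x - real (b 0)" by (simp add: gauss_map_def frac_def fl)
  then show "?y \<longlonglongrightarrow> gauss_map x" using ylim by simp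
qed

lemma cf_unique_aux:
  assumes "x \<notin> \<rat>" "\<forall>n. b n \<ge> 1" "(\<lambda>n. cf_value (map b [0..<n])) \<longlonglongrightarrow> x"
  shows "b n = nat \<lfloor>1 / (gauss_map ^^ n) x\<rfloor>"
  using assms
proof (induction n arbitrary: b x)
  case 0
  then show ?case using cf_shift(1)[of x b] by simp
next
  case (Suc n)
  have "b (Suc n) = nat \<lfloor>1 / (gauss_map ^^ n) (gauss_map x)\<rfloor>"
    using Suc.prems
    by (intro Suc.IH[of "gauss_map x" "\<lambda>k. b (Suc k)"] gauss_map_irrational(1) cf_shift(2)) auto
  then show ?case by (simp add: funpow_swap1)
qed

lemma is_cf_expansion_unique:
  assumes "x \<notin> \<rat>" "is_cf_expansion a x"
  shows "a = gauss_digit x"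
proof
  fix n
  have m: "map a [1..<Suc n] = map (\<lambda>k. a (Suc k)) [0..<n]" for n
    unfolding One_nat_def map_Suc_upt[symmetric] map_map comp_def ..
  show "a n = gauss_digit x n"
  proof (cases n)
    case 0
    then show ?thesis using assms by (simp add: is_cf_expansion_def gauss_digit_def)
  next
    case (Suc k)
    have "a (Suc k) = nat \<lfloor>1 / (gauss_map ^^ k) x\<rfloor>"
      using assms(2)[unfolded is_cf_expansion_def m]
      by (intro cf_unique_aux[OF assms(1), of "\<lambda>k. a (Suc k)"]) auto
    then show ?thesis by (simp add: Suc gauss_digit_def)
  qed
qed

lemma ex1_cf_expansion:
  assumes "x \<in> {0..<1}" "x \<notin> \<rat>"
  shows "\<exists>!a. is_cf_expansion a x"
proof -
  have "x \<noteq> 0" using assms by auto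
  then have "is_cf_expansion (gauss_digit x) x"
    using assms by (intro is_cf_expansion_gauss_digit) auto
  then show ?thesis using is_cf_expansion_unique[OF assms(2)] by (rule ex1I)
qed

text \<open>The partial quotients are those produced by the Gauss map.\<close>

lemma partial_quotients_eq_gauss_digit:
  assumes "x \<in> {0..<1}" "x \<notin> \<rat>"
  shows "partial_quotients x = gauss_digit x"
  unfolding partial_quotients_def
  by (rule is_cf_expansion_unique[OF assms(2) theI'[OF ex1_cf_expansion[OF assms]]])

end

theory Submission
  imports Defs "HOL-Real_Asymp.Real_Asymp"
begin

text \<open>Upper bound: a point of \<open>E(\<alpha>)\<close> satisfies \<open>a\<^sub>n \<le> n\<^sup>\<beta>\<close> for infinitely many \<open>n\<close>, where
  \<open>\<beta> > \<alpha>\<close>, while \<open>a\<^sub>1 \<cdots> a\<^sub>n \<ge> (n!)\<^sup>\<gamma>\<close> eventually, where \<open>\<gamma> < \<alpha>\<close>. There are at most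
  \<open>(n\<^sup>\<beta> + n choose n)\<close> non-decreasing words of length \<open>n\<close> with entries up to \<open>n\<^sup>\<beta>\<close>, about
  \<open>(n!)\<^bsup>\<beta> - 1\<^esup>\<close> up to an exponential factor, and each relevant cylinder has diameter at most
  \<open>(n!)\<^bsup>-2\<gamma>\<^esup>\<close>; so these cylinders form a cover of summable weight once
  \<open>s > (\<beta> - 1) / (2\<gamma>)\<close>. For \<open>\<alpha> < 1\<close> one takes \<open>\<beta> = 1\<close> and replaces \<open>(n!)\<^sup>\<gamma>\<close> by \<open>M\<^sup>n\<close>
  with \<open>M\<close> large.

  Lower bound: let \<open>a\<^sub>n\<close> range over the \<open>\<lfloor>n\<^bsup>\<alpha> - 1\<^esup>\<rfloor>\<close> integers from \<open>\<lceil>n\<^sup>\<alpha>\<rceil>\<close> on, which lie below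
  \<open>(n + 1)\<^sup>\<alpha>\<close>. Reading the choices as mixed radix digits of \<open>t\<close> gives a map from the unit interval
  into \<open>E(\<alpha>)\<close> whose inverse is \<open>s\<close>-Hoelder continuous for every \<open>s < (\<alpha> - 1) / (2\<alpha>)\<close>, so the
  Lebesgue measure of the interval bounds the Hausdorff measure of \<open>E(\<alpha>)\<close> from below.\<close>

section \<open>Positive sequences that eventually double\<close>

lemma doubling_imp_at_top:
  fixes f :: "nat \<Rightarrow> real"
  assumes pos: "\<And>n. f n > 0" and ev: "\<forall>\<^sub>F n in sequentially. f (Suc n) \<ge> 2 * f n"
  shows "filterlim f at_top sequentially"
proof -
  obtain K where K: "\<And>n. n \<ge> K \<Longrightarrow> f (Suc n) \<ge> 2 * f n"
    using ev by (auto simp: eventually_sequentially)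
  have ge: "f (n + K) \<ge> f K * 2 ^ n" for n
  proof (induction n)
    case (Suc n)
    then show ?case using K[of "n + K"] by simp
  qed simp
  have "filterlim (\<lambda>n. f K * 2 ^ n) at_top sequentially"
    using pos[of K] by real_asymp
  then have "filterlim (\<lambda>n. f (n + K)) at_top sequentially"
    by (rule filterlim_at_top_mono) (use ge in auto)
  then show ?thesis
    unfolding filterlim_at_top
    using eventually_sequentially_seg by blast
qed

lemma pos_at_top_imp_bounded_below:
  fixes f :: "nat \<Rightarrow> real"
  assumes pos: "\<And>n. f n > 0" and lim: "filterlim f at_top sequentially"
  obtains c where "c > 0" "\<And>n. f n \<ge> c"
proof -
  obtain K where K: "\<And>n. n \<ge> K \<Longrightarrow> f n \<ge> 1"
    using lim by (auto simp: filterlim_at_top eventually_sequentially)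
  \<comment> \<open>The element 1 accounts for all indices from \<open>K\<close> on.\<close>
  define c where "c = Min (insert 1 (f ` {..<K}))"
  have "c > 0" unfolding c_def using pos by (subst Min_gr_iff) auto
  moreover have "f n \<ge> c" for n
  proof (cases "n < K")
    case True
    then show ?thesis unfolding c_def by (intro Min_le) auto
  next
    case False
    have "c \<le> 1" unfolding c_def by (intro Min_le) auto
    then show ?thesis using K[of n] False by simp
  qed
  ultimately show thesis using that by blast
qed

section \<open>Bounds for Hausdorff measure and dimension\<close>

lemma hausdorff_dim_le:
  assumes "c \<ge> 0" "\<And>s. s > c \<Longrightarrow> hausdorff_measure s A = 0"
  shows "hausdorff_dim A \<le> ereal c"
proof (rule ereal_le_epsilon2)
  fix e :: real assume "0 < e"
  have "hausdorff_dim A \<le> ereal (c + e)"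
    unfolding hausdorff_dim_def using assms \<open>0 < e\<close> by (intro Inf_lower imageI) auto
  then show "hausdorff_dim A \<le> ereal c + ereal e" by simp
qed

lemma hausdorff_dim_nonneg: "hausdorff_dim A \<ge> 0"
  unfolding hausdorff_dim_def by (intro Inf_greatest) auto

lemma hausdorff_dim_ge:
  assumes "\<And>s. 0 \<le> s \<Longrightarrow> s < c \<Longrightarrow> hausdorff_measure s A \<noteq> 0"
  shows "hausdorff_dim A \<ge> ereal c"
  unfolding hausdorff_dim_def
proof (intro Inf_greatest)
  fix y assume "y \<in> ereal ` {s. 0 \<le> s \<and> hausdorff_measure s A = 0}"
  then show "ereal c \<le> y" using assms by (metis (mono_tags, lifting) ereal_less_eq(3) imageE linorder_not_le mem_Collect_eq)
qed

text \<open>Borel-Cantelli argument: every point of \<open>A\<close> lies in sets of infinitely many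
  levels, so the levels from any \<open>K\<close> on cover \<open>A\<close>, and their total weight
  is bounded by a tail of a convergent series.\<close>

lemma hausdorff_measure_limsup_eq_0:
  fixes C :: "'i \<Rightarrow> 'a::metric_space set"
  assumes s: "s > 0" and fin: "\<And>n. finite (W n)"
    and C: "\<And>n w. w \<in> W n \<Longrightarrow> bounded (C w) \<and> diameter (C w) \<le> r n"
    and r: "r \<longlonglongrightarrow> 0"
    and sm: "summable (\<lambda>n. real (card (W n)) * r n powr s)"
    and A: "\<And>x. x \<in> A \<Longrightarrow> \<exists>\<^sub>F n in sequentially. x \<in> (\<Union>w\<in>W n. C w)"
  shows "hausdorff_measure s A = 0"
proof -
  let ?t = "\<lambda>n. real (card (W n)) * r n powr s"
  have "hausdorff_premeasure s \<delta> A \<le> 0" if \<delta>: "\<delta> > 0" for \<delta>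
  proof (rule ennreal_le_epsilon)
    fix e :: real assume e: "e > 0"
    obtain K1 where K1: "\<And>n. n \<ge> K1 \<Longrightarrow> norm (\<Sum>i. ?t (i + n)) < e"
      using suminf_exist_split[OF e sm] by blast
    have "\<forall>\<^sub>F n in sequentially. r n < \<delta>" using r \<delta> by (rule order_tendstoD)
    then obtain K2 where K2: "\<And>n. n \<ge> K2 \<Longrightarrow> r n < \<delta>"
      by (auto simp: eventually_sequentially)
    define K where "K = max K1 K2"
    have "\<exists>g. bij_betw g {0..<card (W n)} (W n)" for n
      using fin by (rule ex_bij_betw_nat_finite)
    then obtain g where g: "\<And>n. bij_betw (g n) {0..<card (W n)} (W n)" by metis
    \<comment> \<open>Each finite level is padded with empty sets, which have weight 0; the pairing
      function then merges all levels into one sequence.\<close>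
    define V where "V n i = (if i < card (W (n + K)) then C (g (n + K) i) else {})" for n i
    define U where "U j = V (fst (prod_decode j)) (snd (prod_decode j))" for j
    have gW: "g n i \<in> W n" if "i < card (W n)" for n i
      using g[of n] that by (auto simp: bij_betw_def)
    have rK: "r (n + K) < \<delta>" for n using K2[of "n + K"] by (simp add: K_def)
    have V: "bounded (V n i) \<and> diameter (V n i) \<le> \<delta>" for n i
      using C[OF gW, of i "n + K"] rK[of n] \<delta> by (auto simp: V_def)
    have "A \<subseteq> (\<Union>j. U j)"
    proof
      fix x assume "x \<in> A"
      then have "\<exists>n\<ge>K. x \<in> (\<Union>w\<in>W n. C w)"
        using A[of x] by (auto simp: frequently_sequentially)
      then obtain n w where n: "n \<ge> K" and w: "w \<in> W n" "x \<in> C w" by auto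
      obtain i where i: "i < card (W n)" "g n i = w"
        using g[of n] w(1) by (auto simp: bij_betw_def image_iff) (metis atLeastLessThan_iff imageE)
      have "x \<in> V (n - K) i" using i w n by (simp add: V_def)
      then have "x \<in> U (prod_encode (n - K, i))" by (simp add: U_def)
      then show "x \<in> (\<Union>j. U j)" by blast
    qed
    then have "hausdorff_premeasure s \<delta> A \<le> (\<Sum>j. hausdorff_weight s (U j))"
      unfolding hausdorff_premeasure_def using V by (intro INF_lower) (auto simp: U_def)
    also have "\<dots> = (\<Sum>n. \<Sum>i. hausdorff_weight s (V n i))"
      using suminf_ennreal_2dimen[of "\<lambda>n. \<Sum>i. hausdorff_weight s (V n i)"
          "\<lambda>(n, i). hausdorff_weight s (V n i)"]
      by (simp add: U_def case_prod_beta)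
    also have "\<dots> \<le> (\<Sum>n. ennreal (?t (n + K)))"
    proof (intro suminf_le)
      fix n
      have "(\<Sum>i. hausdorff_weight s (V n i)) = (\<Sum>i<card (W (n + K)). hausdorff_weight s (V n i))"
        by (intro suminf_finite) (auto simp: V_def hausdorff_weight_def)
      also have "\<dots> \<le> (\<Sum>i<card (W (n + K)). ennreal (r (n + K) powr s))"
      proof (intro sum_mono)
        fix i assume "i \<in> {..<card (W (n + K))}"
        then have "bounded (V n i)" "diameter (V n i) \<le> r (n + K)"
          using C[OF gW, of i "n + K"] by (auto simp: V_def)
        then show "hausdorff_weight s (V n i) \<le> ennreal (r (n + K) powr s)"
          using s diameter_ge_0 by (auto simp: hausdorff_weight_def intro!: ennreal_leI powr_mono2)
      qed
      also have "\<dots> = ennreal (?t (n + K))"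
        by (simp add: ennreal_mult ennreal_of_nat_eq_real_of_nat)
      finally show "(\<Sum>i. hausdorff_weight s (V n i)) \<le> ennreal (?t (n + K))" .
    qed auto
    also have "\<dots> = ennreal (\<Sum>n. ?t (n + K))"
      using summable_ignore_initial_segment[OF sm] by (intro suminf_ennreal2) auto
    also have "\<dots> \<le> ennreal e"
      using K1[of K] by (intro ennreal_leI) (auto simp: K_def)
    finally show "hausdorff_premeasure s \<delta> A \<le> 0 + ennreal e" by simp
  qed
  then show ?thesis unfolding hausdorff_measure_def
    by (intro antisym SUP_least) auto
qed

text \<open>At exponent 0 every cover has weight at least 1, because one of its sets is
  nonempty.\<close>

lemma hausdorff_measure_zero_nonempty:
  assumes "A \<noteq> {}" shows "hausdorff_measure 0 A \<noteq> 0"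
proof -
  have "1 \<le> hausdorff_premeasure 0 1 A"
    unfolding hausdorff_premeasure_def
  proof (intro INF_greatest)
    fix U assume "U \<in> {U. A \<subseteq> (\<Union>i::nat. U i) \<and> (\<forall>i. bounded (U i) \<and> diameter (U i) \<le> 1)}"
    then obtain i where "U i \<noteq> {}" using assms by blast
    then have "1 = hausdorff_weight 0 (U i)" by (simp add: hausdorff_weight_def)
    also have "\<dots> = (\<Sum>j\<in>{i}. hausdorff_weight 0 (U j))" by simp
    also have "\<dots> \<le> (\<Sum>j. hausdorff_weight 0 (U j))" by (intro sum_le_suminf) auto
    finally show "1 \<le> (\<Sum>j. hausdorff_weight 0 (U j))" .
  qed
  also have "\<dots> \<le> hausdorff_measure 0 A"
    unfolding hausdorff_measure_def by (intro SUP_upper) auto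
  finally show ?thesis by auto
qed

text \<open>Mass distribution: a cover of \<open>A\<close> pulls back along \<open>h\<close> to a
  cover of the unit interval, and the preimage of a set of diameter \<open>d\<close> lies in an
  interval of length \<open>2 * C * d powr s\<close>. As the lengths add up to at least 1, the
  weights add up to at least \<open>1 / (2 * C)\<close>.\<close>

lemma hausdorff_measure_nonzero_if_inverse_Hoelder:
  fixes h :: "real \<Rightarrow> 'a::metric_space"
  assumes s: "s > 0" and C: "C > 0"
    and hA: "h ` {0..<1} \<subseteq> A"
    and h: "\<And>t t'. t \<in> {0..<1} \<Longrightarrow> t' \<in> {0..<1} \<Longrightarrow> \<bar>t - t'\<bar> \<le> C * dist (h t) (h t') powr s"
  shows "hausdorff_measure s A \<noteq> 0"
proof -
  have "ennreal (1 / (2 * C)) \<le> hausdorff_premeasure s 1 A"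
    unfolding hausdorff_premeasure_def
  proof (intro INF_greatest)
    fix U assume "U \<in> {U. A \<subseteq> (\<Union>i::nat. U i) \<and> (\<forall>i. bounded (U i) \<and> diameter (U i) \<le> 1)}"
    then have cov: "A \<subseteq> (\<Union>i. U i)" and bd: "\<And>i. bounded (U i)" by auto
    define d where "d i = C * diameter (U i) powr s" for i
    \<comment> \<open>Since \<open>h\<close> need not be measurable, each preimage is enclosed in a
      measurable set; the closed interval of radius \<open>d i\<close> about any of its points will
      do.\<close>
    have "\<exists>I. I \<in> sets lborel \<and> {t\<in>{0..<1}. h t \<in> U i} \<subseteq> I \<and>
        emeasure lborel I \<le> ennreal (2 * C) * hausdorff_weight s (U i)" for i
    proof (cases "{t\<in>{0..<1}. h t \<in> U i} = {}")
      case True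
      then show ?thesis by (intro exI[of _ "{}"]) auto
    next
      case False
      then obtain t where t: "t \<in> {0..<1}" "h t \<in> U i" by blast
      have "t' \<in> {t - d i..t + d i}" if "t' \<in> {0..<1}" "h t' \<in> U i" for t'
      proof -
        have "\<bar>t - t'\<bar> \<le> C * dist (h t) (h t') powr s" using h t that by blast
        also have "\<dots> \<le> d i" unfolding d_def
          using C s diameter_bounded_bound[OF bd t(2) that(2)]
          by (intro mult_left_mono powr_mono2) auto
        finally show ?thesis by auto
      qed
      moreover have "emeasure lborel {t - d i..t + d i} = ennreal (2 * C) * hausdorff_weight s (U i)"
        using t(2) C s by (auto simp: d_def hausdorff_weight_def ennreal_mult[symmetric])
      ultimately show ?thesis by (intro exI[of _ "{t - d i..t + d i}"]) auto
    qed
    then obtain I where I: "\<And>i. I i \<in> sets lborel"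
      "\<And>i. {t\<in>{0..<1}. h t \<in> U i} \<subseteq> I i"
      "\<And>i. emeasure lborel (I i) \<le> ennreal (2 * C) * hausdorff_weight s (U i)" by metis
    have "{0..<1} \<subseteq> (\<Union>i. I i)" using cov hA I(2) by blast
    then have "emeasure lborel {0..<1::real} \<le> emeasure lborel (\<Union>i. I i)"
      using I(1) by (intro emeasure_mono) auto
    also have "\<dots> \<le> (\<Sum>i. emeasure lborel (I i))"
      using I(1) by (intro emeasure_subadditive_countably) auto
    also have "\<dots> \<le> (\<Sum>i. ennreal (2 * C) * hausdorff_weight s (U i))"
      using I(3) by (intro suminf_le) auto
    also have "\<dots> = ennreal (2 * C) * (\<Sum>i. hausdorff_weight s (U i))" by simp
    finally have *: "1 \<le> ennreal (2 * C) * (\<Sum>i. hausdorff_weight s (U i))" by simp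
    have "ennreal (1 / (2 * C)) \<le> ennreal (1 / (2 * C)) * (ennreal (2 * C) * (\<Sum>i. hausdorff_weight s (U i)))"
      using mult_left_mono[OF *, of "ennreal (1 / (2 * C))"] by simp
    also have "\<dots> = (\<Sum>i. hausdorff_weight s (U i))"
      using C by (simp add: mult.assoc[symmetric] ennreal_mult[symmetric])
    finally show "ennreal (1 / (2 * C)) \<le> (\<Sum>i. hausdorff_weight s (U i))" .
  qed
  also have "\<dots> \<le> hausdorff_measure s A"
    unfolding hausdorff_measure_def by (intro SUP_upper) auto
  finally show ?thesis using C by (auto simp: ennreal_eq_0_iff)
qed

section \<open>Infinite continued fractions\<close>

text \<open>Indices start at 0 here, so that \<open>b k\<close> is the partial quotient number k + 1
  and the integer part is left out.\<close>

definition cf_lim :: "(nat \<Rightarrow> nat) \<Rightarrow> real" where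
  "cf_lim b = lim (\<lambda>n. cf_value (map b [0..<n]))"

text \<open>Finite expansions of length at least 2k share their first 2k quotients, and every two
  common quotients halve the distance.\<close>

lemma cf_lim_LIMSEQ:
  assumes b: "\<And>k. b k \<ge> 1"
  shows "(\<lambda>n. cf_value (map b [0..<n])) \<longlonglongrightarrow> cf_lim b"
proof -
  have "Cauchy (\<lambda>n. cf_value (map b [0..<n]))"
  proof (rule metric_CauchyI)
    fix e :: real assume "e > 0"
    then obtain k where k: "(1/2::real) ^ k < e" using real_arch_pow_inv[of e "1/2"] by auto
    have split: "cf_value (map b [0..<n]) =
        cf_tail (map b [0..<2*k]) (cf_tail (map b [2*k..<n]) 0)" if "n \<ge> 2 * k" for n
      using that upt_add_eq_append[of 0 "2*k" "n - 2*k"]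
      by (simp add: cf_value_eq_tail cf_tail_append[symmetric] map_append[symmetric] del: map_append)
    have range: "0 \<le> cf_tail (map b [2*k..<n]) 0 \<and> cf_tail (map b [2*k..<n]) 0 \<le> 1" for n
      using b by (intro cf_tail_range) auto
    have "dist (cf_value (map b [0..<m])) (cf_value (map b [0..<n])) < e"
      if "m \<ge> 2 * k" "n \<ge> 2 * k" for m n
    proof -
      have "dist (cf_value (map b [0..<m])) (cf_value (map b [0..<n]))
          \<le> (1/2) ^ (length (map b [0..<2*k]) div 2)"
        unfolding split[OF that(1)] split[OF that(2)] dist_real_def
        using b range by (intro cf_tail_diff) auto
      then show ?thesis using k by simp
    qed
    then show "\<exists>M. \<forall>m\<ge>M. \<forall>n\<ge>M. dist (cf_value (map b [0..<m])) (cf_value (map b [0..<n])) < e"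
      by blast
  qed
  then show ?thesis
    unfolding cf_lim_def by (simp add: Cauchy_convergent_iff convergent_LIMSEQ_iff)
qed

lemma cf_lim_range:
  assumes b: "\<And>k. b k \<ge> 1"
  shows "0 \<le> cf_lim b" "cf_lim b \<le> 1"
proof -
  have r: "0 \<le> cf_value (map b [0..<n]) \<and> cf_value (map b [0..<n]) \<le> 1" for n
    unfolding cf_value_eq_tail using b by (intro cf_tail_range) auto
  show "0 \<le> cf_lim b" by (rule LIMSEQ_le_const[OF cf_lim_LIMSEQ[OF b]]) (use r in blast)
  show "cf_lim b \<le> 1" by (rule LIMSEQ_le_const2[OF cf_lim_LIMSEQ[OF b]]) (use r in blast)
qed

lemma cf_lim_unfold:
  assumes b: "\<And>k. b k \<ge> 1"
  shows "cf_lim b = 1 / (real (b 0) + cf_lim (\<lambda>k. b (Suc k)))"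
proof -
  have eq: "cf_value (map b [0..<Suc n]) = 1 / (real (b 0) + cf_value (map (\<lambda>k. b (Suc k)) [0..<n]))" for n
    by (subst map_upt_Suc) simp
  have "(\<lambda>n. cf_value (map (\<lambda>k. b (Suc k)) [0..<n])) \<longlonglongrightarrow> cf_lim (\<lambda>k. b (Suc k))"
    by (rule cf_lim_LIMSEQ) (use b in auto)
  moreover have "real (b 0) + cf_lim (\<lambda>k. b (Suc k)) \<noteq> 0"
    using cf_lim_range(1)[of "\<lambda>k. b (Suc k)", OF b] b[of 0] by linarith
  ultimately have "(\<lambda>n. cf_value (map b [0..<Suc n])) \<longlonglongrightarrow> 1 / (real (b 0) + cf_lim (\<lambda>k. b (Suc k)))"
    unfolding eq by (intro tendsto_intros)
  moreover have "(\<lambda>n. cf_value (map b [0..<Suc n])) \<longlonglongrightarrow> cf_lim b"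
    using cf_lim_LIMSEQ[OF b] by (rule LIMSEQ_Suc)
  ultimately show ?thesis by (intro LIMSEQ_unique)
qed

lemma cf_lim_gt_0:
  assumes b: "\<And>k. b k \<ge> 1" shows "cf_lim b > 0"
proof -
  have "real (b 0) + cf_lim (\<lambda>k. b (Suc k)) > 0"
    using cf_lim_range(1)[of "\<lambda>k. b (Suc k)", OF b] b[of 0] by linarith
  then show ?thesis unfolding cf_lim_unfold[of b, OF b] by simp
qed

lemma cf_lim_less:
  assumes b: "\<And>k. b k \<ge> 1" shows "cf_lim b < 1 / real (b 0)"
proof -
  have "real (b 0) > 0" "cf_lim (\<lambda>k. b (Suc k)) > 0"
    using cf_lim_gt_0[of "\<lambda>k. b (Suc k)", OF b] b[of 0] by simp_all
  then show ?thesis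
    unfolding cf_lim_unfold[of b, OF b] by (simp add: frac_less2)
qed

lemma cf_lim_lt_1:
  assumes b: "\<And>k. b k \<ge> 1" shows "cf_lim b < 1"
proof -
  have "1 / real (b 0) \<le> 1" using b[of 0] by (simp add: divide_simps)
  then show ?thesis using cf_lim_less[of b, OF b] by linarith
qed

text \<open>Infinite descent on the denominator: each step of the expansion turns a fraction
  \<open>p / q\<close> in the unit interval into one with denominator \<open>p < q\<close>.\<close>

lemma cf_lim_irrational:
  assumes "\<And>k. b k \<ge> 1" shows "cf_lim b \<notin> \<rat>"
proof -
  have "cf_lim b * real q \<notin> \<int>" if "q > 0" "\<And>k. b k \<ge> 1" for q b
    using that
  proof (induction q arbitrary: b rule: less_induct)
    case (less q)
    show ?case
    proof
      assume "cf_lim b * real q \<in> \<int>"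
      then obtain p where p: "cf_lim b * real q = of_int p" by (auto elim: Ints_cases)
      have b: "\<And>k. b k \<ge> 1" using less by blast
      let ?y = "cf_lim (\<lambda>k. b (Suc k))"
      have x: "0 < cf_lim b" "cf_lim b < 1" using cf_lim_gt_0 cf_lim_lt_1 b by auto
      then have "0 < real_of_int p" "real_of_int p < real q"
        using p less.prems(1) by (auto simp flip: p)
      then have pq: "0 < p" "p < int q" by linarith+
      have "cf_lim b * (real (b 0) + ?y) = 1"
        using cf_lim_unfold[of b] b cf_lim_gt_0[of b] by (auto simp: field_simps)
      moreover have "real_of_int p * (real (b 0) + ?y) = cf_lim b * (real (b 0) + ?y) * real q"
        unfolding p[symmetric] by (simp only: mult_ac)
      ultimately have "real_of_int p * (real (b 0) + ?y) = real q" by simp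
      then have "?y * real (nat p) = of_int (int q - p * int (b 0))"
        using pq by (simp add: algebra_simps)
      then have "?y * real (nat p) \<in> \<int>" by (metis Ints_of_int)
      moreover have "?y * real (nat p) \<notin> \<int>"
        using pq b by (intro less.IH) auto
      ultimately show False by blast
    qed
  qed
  note no_denom = this
  show ?thesis
  proof
    assume "cf_lim b \<in> \<rat>"
    then obtain m n :: int where "n > 0" "cf_lim b = of_int m / of_int n"
      by (auto elim: Rats_cases')
    then have "cf_lim b * real (nat n) = of_int m" by simp
    then show False using no_denom[of "nat n" b] \<open>n > 0\<close> assms by simp
  qed
qed

text \<open>This places the number in the cylinder of its first \<open>n\<close> quotients.\<close>

lemma cf_lim_eq_tail:
  assumes b: "\<And>k. b k \<ge> 1"
  shows "cf_lim b = cf_tail (map b [0..<n]) (cf_lim (\<lambda>k. b (k + n)))"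
proof (induction n)
  case (Suc n)
  have "cf_lim (\<lambda>k. b (k + n)) = cf_tail [b n] (cf_lim (\<lambda>k. b (k + Suc n)))"
    using cf_lim_unfold[of "\<lambda>k. b (k + n)"] b by simp
  then show ?case using Suc by (simp add: cf_tail_append)
qed simp

lemma map_partial_quotients_shift: "map a [1..<Suc n] = map (\<lambda>k. a (Suc k)) [0..<n]"
  unfolding One_nat_def map_Suc_upt[symmetric] map_map comp_def ..

text \<open>With 0 put in front, \<open>b\<close> is an expansion of the irrational number
  \<open>cf_lim b\<close>, and expansions of irrationals are unique.\<close>

lemma partial_quotients_cf_lim:
  assumes b: "\<And>k. b k \<ge> 1"
  shows "partial_quotients (cf_lim b) (Suc n) = b n"
proof -
  define a where "a n = (case n of 0 \<Rightarrow> 0 | Suc k \<Rightarrow> b k)" for n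
  have "is_cf_expansion a (cf_lim b)"
    unfolding is_cf_expansion_def map_partial_quotients_shift
    using cf_lim_LIMSEQ[of b] b by (auto simp: a_def split: nat.splits)
  moreover have "cf_lim b \<in> {0..<1}" "cf_lim b \<notin> \<rat>"
    using cf_lim_gt_0[of b] cf_lim_lt_1[of b] cf_lim_irrational[of b] b by auto
  ultimately have "partial_quotients (cf_lim b) = a"
    using is_cf_expansion_unique partial_quotients_eq_gauss_digit by metis
  then show ?thesis by (simp add: a_def)
qed

lemma
  assumes "x \<in> {0..<1}" "x \<notin> \<rat>"
  shows partial_quotients_ge_1: "partial_quotients x (Suc k) \<ge> 1"
    and cf_lim_partial_quotients: "cf_lim (\<lambda>k. partial_quotients x (Suc k)) = x"
proof -
  have e: "is_cf_expansion (partial_quotients x) x"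
    unfolding partial_quotients_def by (rule theI'[OF ex1_cf_expansion[OF assms]])
  then show pos: "partial_quotients x (Suc k) \<ge> 1" for k by (auto simp: is_cf_expansion_def)
  have "(\<lambda>n. cf_value (map (\<lambda>k. partial_quotients x (Suc k)) [0..<n])) \<longlonglongrightarrow> x"
    using e unfolding is_cf_expansion_def map_partial_quotients_shift by blast
  then show "cf_lim (\<lambda>k. partial_quotients x (Suc k)) = x"
    unfolding cf_lim_def by (rule limI)
qed

section \<open>Cylinder diameters and separation of continued fractions\<close>

lemma recip_add_diff:
  fixes a y z :: real
  assumes "a > 0" "y \<ge> 0" "z \<ge> 0"
  shows "\<bar>1 / (a + y) - 1 / (a + z)\<bar> = \<bar>y - z\<bar> / ((a + y) * (a + z))"
proof -
  have "1 / (a + y) - 1 / (a + z) = (z - y) / ((a + y) * (a + z))"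
    using assms by (simp add: field_simps)
  then show ?thesis using assms by (simp add: abs_mult abs_minus_commute)
qed

text \<open>Prepending a quotient \<open>a\<close> divides distances by a product of two
  denominators, both at least \<open>a\<close>.\<close>

lemma cf_tail_diff_prod_list:
  assumes "\<forall>a\<in>set w. a \<ge> 1" "0 \<le> y" "y \<le> 1" "0 \<le> z" "z \<le> 1"
  shows "\<bar>cf_tail w y - cf_tail w z\<bar> \<le> 1 / (real (prod_list w))\<^sup>2"
  using assms(1)
proof (induction w)
  case Nil
  then show ?case using assms by simp
next
  case (Cons a w)
  have r: "0 \<le> cf_tail w y" "0 \<le> cf_tail w z" using Cons assms cf_tail_range by auto
  have a: "real a > 0" using Cons by auto
  have "\<bar>cf_tail (a # w) y - cf_tail (a # w) z\<bar> =
      \<bar>cf_tail w y - cf_tail w z\<bar> / ((real a + cf_tail w y) * (real a + cf_tail w z))"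
    using recip_add_diff[OF a r] by simp
  also have "\<dots> \<le> (1 / (real (prod_list w))\<^sup>2) / (real a * real a)"
    using Cons a r by (intro frac_le mult_mono) auto
  finally show ?case by (simp add: power2_eq_square mult_ac)
qed

text \<open>The image of the unit interval under \<open>cf_tail w\<close> contains the cylinder of
  \<open>w\<close>; these images are the covering sets of the upper bound.\<close>

lemma cylinder_diameter:
  assumes "\<forall>a\<in>set w. a \<ge> 1"
  shows "bounded (cf_tail w ` {0..1})" "diameter (cf_tail w ` {0..1}) \<le> 1 / (real (prod_list w))\<^sup>2"
proof -
  have "cf_tail w ` {0..1} \<subseteq> {0..1}" using cf_tail_range[OF assms] by auto
  then show "bounded (cf_tail w ` {0..1})"
    using bounded_closed_interval bounded_subset by blast
  show "diameter (cf_tail w ` {0..1}) \<le> 1 / (real (prod_list w))\<^sup>2"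
    using cf_tail_diff_prod_list[OF assms] by (intro diameter_le) auto
qed

text \<open>Induction on the first index \<open>n\<close> at which the quotients differ. A common
  quotient \<open>b 0\<close> divides distances by at most the square of \<open>v 0\<close>, because
  the denominators are at most \<open>b 0 + 1\<close>. At index \<open>n\<close> the two
  denominators differ by at least 1/2, the origin of the factor 2.\<close>

lemma cf_lim_separation:
  assumes "\<And>k. b k \<ge> 1" "\<And>k. c k \<ge> 1" "b (Suc n) \<ge> 2" "c (Suc n) \<ge> 2"
    and "\<And>k. k < n \<Longrightarrow> b k = c k" "b n \<noteq> c n"
    and "\<And>k. k \<le> n \<Longrightarrow> real (b k) + 1 \<le> v k" "\<And>k. k \<le> n \<Longrightarrow> real (c k) + 1 \<le> v k"
  shows "\<bar>cf_lim b - cf_lim c\<bar> \<ge> 1 / (2 * (\<Prod>k\<le>n. v k)\<^sup>2)"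
  using assms
proof (induction n arbitrary: b c v)
  case 0
  define y z where "y = cf_lim (\<lambda>k. b (Suc k))" and "z = cf_lim (\<lambda>k. c (Suc k))"
  have "1 / real n \<le> 1/2" if "n \<ge> 2" for n :: nat using that by (simp add: divide_simps)
  then have le2: "1 / real (b 1) \<le> 1/2" "1 / real (c 1) \<le> 1/2" using 0(3,4) by auto
  have "y < 1 / real (b 1)" "z < 1 / real (c 1)"
    unfolding y_def z_def
    using cf_lim_less[of "\<lambda>k. b (Suc k)"] cf_lim_less[of "\<lambda>k. c (Suc k)"] 0 by auto
  \<comment> \<open>Quotients of at least 2 at the next index keep both tails below 1/2, so that
    they cannot cancel the difference of at least 1 between \<open>b 0\<close> and
    \<open>c 0\<close>.\<close>
  then have yz: "y < 1/2" "z < 1/2" using le2 by linarith+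
  have yz0: "y > 0" "z > 0" unfolding y_def z_def using 0 by (auto intro: cf_lim_gt_0)
  have bc: "real (b 0) \<ge> 1" "real (c 0) \<ge> 1" using 0(1)[of 0] 0(2)[of 0] by simp_all
  have v: "real (b 0) + 1 \<le> v 0" "real (c 0) + 1 \<le> v 0" using 0 by auto
  define p q where "p = real (b 0) + y" and "q = real (c 0) + z"
  have "real (b 0) \<le> real (c 0) - 1 \<or> real (c 0) \<le> real (b 0) - 1" using 0(6) by linarith
  then have pq: "\<bar>q - p\<bar> \<ge> 1/2" using yz yz0 by (auto simp: p_def q_def)
  have p: "0 < p" "p \<le> v 0" "0 < q" "q \<le> v 0" using yz yz0 bc v by (auto simp: p_def q_def)
  have "1 / (2 * (v 0)\<^sup>2) = (1/2) / (v 0 * v 0)" by (simp add: power2_eq_square)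
  also have "\<dots> \<le> \<bar>q - p\<bar> / (p * q)" using pq p by (intro frac_le mult_mono) auto
  also have "\<dots> = \<bar>1 / p - 1 / q\<bar>" using p by (simp add: diff_frac_eq abs_mult)
  also have "1 / p - 1 / q = cf_lim b - cf_lim c"
    using cf_lim_unfold[of b, OF 0(1)] cf_lim_unfold[of c, OF 0(2)]
    by (simp add: p_def q_def y_def z_def)
  finally show ?case by simp
next
  case (Suc n)
  define y z where "y = cf_lim (\<lambda>k. b (Suc k))" and "z = cf_lim (\<lambda>k. c (Suc k))"
  have IH: "1 / (2 * (\<Prod>k\<le>n. v (Suc k))\<^sup>2) \<le> \<bar>y - z\<bar>"
    unfolding y_def z_def using Suc.prems by (intro Suc.IH) auto
  have yz: "0 \<le> y" "y \<le> 1" "0 \<le> z" "z \<le> 1"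
    unfolding y_def z_def using Suc.prems by (auto intro: cf_lim_range)
  have b0: "real (b 0) > 0" "c 0 = b 0" using Suc.prems(1)[of 0] Suc.prems(5)[of 0] by auto
  have v: "real (b 0) + 1 \<le> v 0" using Suc.prems by auto
  have "1 / (2 * (\<Prod>k\<le>Suc n. v k)\<^sup>2) = 1 / (2 * (\<Prod>k\<le>n. v (Suc k))\<^sup>2) / (v 0 * v 0)"
    by (simp only: prod.atMost_Suc_shift) (simp add: power2_eq_square mult_ac)
  also have "\<dots> \<le> \<bar>y - z\<bar> / ((real (b 0) + y) * (real (b 0) + z))"
    using IH yz b0 v by (intro frac_le mult_mono) auto
  also have "\<dots> = \<bar>1 / (real (b 0) + y) - 1 / (real (b 0) + z)\<bar>"
    using recip_add_diff[OF b0(1) yz(1,3)] by simp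
  also have "\<dots> = \<bar>cf_lim b - cf_lim c\<bar>"
    using cf_lim_unfold[of b, OF Suc.prems(1)] cf_lim_unfold[of c, OF Suc.prems(2)] b0(2)
    by (simp add: y_def z_def)
  finally show ?case .
qed

section \<open>Counting non-decreasing words\<close>

text \<open>For n \<ge> 1, the possible first \<open>n\<close> quotients of an element of
  \<open>Lambda_set\<close> whose quotient number \<open>n\<close> is at most
  \<open>N\<close>.\<close>

definition sorted_words :: "nat \<Rightarrow> nat \<Rightarrow> nat list set" where
  "sorted_words n N = {w. length w = n \<and> sorted w \<and> set w \<subseteq> {1..N}}"

lemma finite_sorted_words: "finite (sorted_words n N)"
  by (rule finite_subset[OF _ finite_lists_length_eq[of "{1..N}" n]]) (auto simp: sorted_words_def)

text \<open>Pascal's rule: a sorted word either ends in the largest letter \<open>N\<close>, which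
  can be removed, or avoids that letter altogether. One branch shortens the word and the other the
  alphabet, hence the induction on \<open>n + N\<close>.\<close>

lemma card_sorted_words_le: "card (sorted_words n N) \<le> (N + n) choose n"
proof (induction "n + N" arbitrary: n N)
  case 0
  then have "sorted_words n N \<subseteq> {[]}" by (auto simp: sorted_words_def)
  then show ?case using 0 card_mono[of "{[]}" "sorted_words n N"] by simp
next
  case (Suc s)
  show ?case
  proof (cases "n = 0 \<or> N = 0")
    case True
    then have "sorted_words n N \<subseteq> (if n = 0 then {[]} else {})" by (auto simp: sorted_words_def)
    then show ?thesis using card_mono[of "{[]}" "sorted_words n N"] by (auto split: if_splits)
  next
    case False
    then obtain n' N' where n: "n = Suc n'" and N: "N = Suc N'" by (auto simp: gr0_conv_Suc)
    have "sorted_words n N \<subseteq> (\<lambda>w. w @ [N]) ` sorted_words n' N \<union> sorted_words n N'"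
    proof
      fix w assume w: "w \<in> sorted_words n N"
      then obtain u z where u: "w = u @ [z]" "length u = n'"
        by (cases w rule: rev_cases) (auto simp: sorted_words_def n)
      show "w \<in> (\<lambda>w. w @ [N]) ` sorted_words n' N \<union> sorted_words n N'"
      proof (cases "z = N")
        case True
        then show ?thesis using w u by (auto simp: sorted_words_def sorted_append)
      next
        case False
        then have "z \<le> N'" using w u by (auto simp: sorted_words_def N)
        then have "set w \<subseteq> {1..N'}"
          using w u by (force simp: sorted_words_def sorted_append)
        then show ?thesis using w by (auto simp: sorted_words_def)
      qed
    qed
    then have "card (sorted_words n N) \<le> card ((\<lambda>w. w @ [N]) ` sorted_words n' N \<union> sorted_words n N')"
      by (intro card_mono) (auto simp: finite_sorted_words)
    also have "\<dots> \<le> card ((\<lambda>w. w @ [N]) ` sorted_words n' N) + card (sorted_words n N')"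
      by (rule card_Un_le)
    also have "\<dots> \<le> card (sorted_words n' N) + card (sorted_words n N')"
      by (intro add_right_mono card_image_le finite_sorted_words)
    also have "\<dots> \<le> ((N + n') choose n') + ((N' + n) choose n)"
      using Suc(2) n N by (intro add_mono Suc(1)) auto
    also have "\<dots> = (N + n) choose n" by (simp add: n N)
    finally show ?thesis .
  qed
qed

section \<open>The upper bound\<close>

text \<open>Level \<open>n\<close> of the cover consists of the cylinders of sorted words with
  entries up to \<open>N n\<close> and product at least that of the first \<open>n\<close> values of
  \<open>p\<close>. The factor 2 in the last hypothesis makes up for the finitely many quotients
  that may violate it.\<close>

lemma hausdorff_measure_slow_growth_eq_0:
  assumes s: "s > 0" and A: "A \<subseteq> Lambda_set"
    and p0: "\<And>k. p k > 0" and p2: "\<forall>\<^sub>F k in sequentially. p k \<ge> 2"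
    and sm: "summable (\<lambda>n. real ((N n + n) choose n) * (\<Prod>k<n. p k) powr (- 2 * s))"
    and le: "\<And>x. x \<in> A \<Longrightarrow> \<exists>\<^sub>F n in sequentially. partial_quotients x n \<le> N n"
    and ge: "\<And>x. x \<in> A \<Longrightarrow> \<forall>\<^sub>F k in sequentially. real (partial_quotients x (Suc k)) \<ge> 2 * p k"
  shows "hausdorff_measure s A = 0"
proof (rule hausdorff_measure_limsup_eq_0[OF s])
  define P where "P n = (\<Prod>k<n. p k)" for n
  let ?W = "\<lambda>n. {w \<in> sorted_words n (N n). real (prod_list w) \<ge> P n}"
  let ?C = "\<lambda>w. cf_tail w ` {0..1}"
  have P0: "P n > 0" for n unfolding P_def using p0 by (intro prod_pos) auto
  have "filterlim P at_top sequentially"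
  proof (rule doubling_imp_at_top[OF P0])
    show "\<forall>\<^sub>F n in sequentially. 2 * P n \<le> P (Suc n)"
      using p2 by eventually_elim (use P0 in \<open>auto simp: P_def mult.commute intro!: mult_right_mono less_imp_le\<close>)
  qed
  then show "(\<lambda>n. 1 / (P n)\<^sup>2) \<longlonglongrightarrow> 0"
    by (intro tendsto_divide_0[OF tendsto_const] filterlim_at_top_imp_at_infinity
        filterlim_pow_at_top) auto
  show "finite (?W n)" for n using finite_sorted_words by simp
  show "bounded (?C w) \<and> diameter (?C w) \<le> 1 / (P n)\<^sup>2" if "w \<in> ?W n" for n w
  proof -
    have w: "\<forall>a\<in>set w. a \<ge> 1" using that by (auto simp: sorted_words_def)
    have "1 / (real (prod_list w))\<^sup>2 \<le> 1 / (P n)\<^sup>2"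
      using that P0[of n] by (intro frac_le power_mono) auto
    then show ?thesis using cylinder_diameter[OF w] by linarith
  qed
  have powr: "(1 / (P n)\<^sup>2) powr s = P n powr (- 2 * s)" for n
    using P0[of n] by (simp add: powr_minus powr_powr powr_divide inverse_eq_divide flip: powr_numeral)
  show "summable (\<lambda>n. real (card (?W n)) * (1 / (P n)\<^sup>2) powr s)"
  proof (rule summable_comparison_test'[OF sm])
    fix n :: nat
    have "card (?W n) \<le> card (sorted_words n (N n))"
      using finite_sorted_words by (intro card_mono) auto
    also have "\<dots> \<le> (N n + n) choose n" by (rule card_sorted_words_le)
    finally have "real (card (?W n)) \<le> real ((N n + n) choose n)" by simp
    then show "norm (real (card (?W n)) * (1 / (P n)\<^sup>2) powr s)
        \<le> real ((N n + n) choose n) * (\<Prod>k<n. p k) powr (- 2 * s)"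
      unfolding powr by (simp add: P_def mult_right_mono)
  qed
  fix x assume x: "x \<in> A"
  then have x\<Lambda>: "x \<in> {0..<1}" "x \<notin> \<rat>" and mono: "mono_on {1..} (partial_quotients x)"
    using A by (auto simp: Lambda_set_def)
  define b where "b k = partial_quotients x (Suc k)" for k
  have b_lim: "cf_lim b = x"
    using cf_lim_partial_quotients[OF x\<Lambda>] by (simp add: b_def[abs_def])
  have b1: "b k \<ge> 1" for k using partial_quotients_ge_1[OF x\<Lambda>] by (simp add: b_def)
  have bmono: "b i \<le> b j" if "i \<le> j" for i j
    unfolding b_def using mono that by (auto simp: mono_on_def)
  \<comment> \<open>The product of the quotients relative to \<open>P n\<close>: its factors are
    eventually at least 2, so it tends to infinity however small the first factors are, and
    \<open>P n\<close> is eventually a lower bound for the product.\<close>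
  define f where "f n = (\<Prod>k<n. real (b k) / p k)" for n
  have f0: "f n > 0" for n
    unfolding f_def using b1 p0 by (intro prod_pos) (auto simp: Suc_le_eq)
  have "\<forall>\<^sub>F n in sequentially. 2 * f n \<le> f (Suc n)"
    using ge[OF x]
  proof eventually_elim
    case (elim n)
    then have "2 \<le> real (b n) / p n" using p0[of n] by (simp add: b_def pos_le_divide_eq)
    have "f (Suc n) = real (b n) / p n * f n" by (simp add: f_def)
    with \<open>2 \<le> real (b n) / p n\<close> show ?case using f0[of n] by (simp only: mult_right_mono less_imp_le)
  qed
  then have "filterlim f at_top sequentially" by (rule doubling_imp_at_top[OF f0])
  then have "\<forall>\<^sub>F n in sequentially. f n \<ge> 1" by (simp add: filterlim_at_top)
  then have ev: "\<forall>\<^sub>F n in sequentially. n \<ge> 1 \<and> (\<Prod>k<n. real (b k)) \<ge> P n"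
    using eventually_ge_at_top[of 1]
  proof eventually_elim
    case (elim n)
    then have "1 \<le> (\<Prod>k<n. real (b k)) / P n" by (simp add: f_def P_def prod_dividef)
    then show ?case using elim P0[of n] by simp
  qed
  show "\<exists>\<^sub>F n in sequentially. x \<in> (\<Union>w\<in>?W n. ?C w)"
  proof (rule frequently_rev_mp[OF le[OF x]], use ev in eventually_elim, intro impI)
    fix n assume n: "n \<ge> 1 \<and> P n \<le> (\<Prod>k<n. real (b k))" and N: "partial_quotients x n \<le> N n"
    let ?w = "map b [0..<n]"
    \<comment> \<open>As \<open>b\<close> starts at 0, quotient number \<open>n\<close> is
      \<open>b (n - 1)\<close>; by monotonicity its bound \<open>N n\<close> holds for the whole
      word.\<close>
    have "b k \<le> N n" if "k < n" for k
    proof -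
      have "b k \<le> b (n - 1)" using that by (intro bmono) simp
      then show ?thesis using n N by (simp add: b_def)
    qed
    then have "?w \<in> sorted_words n (N n)"
      using b1 bmono by (auto simp: sorted_words_def sorted_map intro: sorted_wrt_mono_rel[OF _ sorted_upt])
    moreover have "prod_list ?w = (\<Prod>k<n. b k)"
      by (simp add: prod.distinct_set_conv_list[symmetric] atLeast0LessThan)
    moreover have "x = cf_tail ?w (cf_lim (\<lambda>k. b (k + n)))"
      using cf_lim_eq_tail[of b n, OF b1] b_lim by simp
    moreover have "cf_lim (\<lambda>k. b (k + n)) \<in> {0..1}"
      using cf_lim_range[of "\<lambda>k. b (k + n)", OF b1] by simp
    ultimately show "x \<in> (\<Union>w\<in>?W n. ?C w)" using n by (intro UN_I[of ?w]) auto
  qed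
qed

section \<open>Growth of the quotients in \<open>E_set\<close> and vanishing of its Hausdorff
  measures\<close>

lemma E_set_subset_Lambda_set: "E_set \<alpha> \<subseteq> Lambda_set"
  by (auto simp: E_set_def)

lemma Lambda_set_partial_quotients_ge_1:
  assumes "x \<in> Lambda_set" "n \<ge> 1" shows "partial_quotients x n \<ge> 1"
  using assms partial_quotients_ge_1[of x "n - 1"] by (auto simp: Lambda_set_def)

text \<open>Failure would make the quotient of logarithms at least \<beta> from some index on, and
  so the lower limit too.\<close>

lemma E_set_frequently_le:
  assumes x: "x \<in> E_set \<alpha>" and \<beta>: "\<alpha> < \<beta>"
  shows "\<exists>\<^sub>F n in sequentially. real (partial_quotients x n) \<le> real n powr \<beta>"
proof (rule ccontr)
  assume "\<not> ?thesis"
  then have "\<forall>\<^sub>F n in sequentially. real n powr \<beta> < real (partial_quotients x n)"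
    by (simp add: frequently_def not_le)
  then have "\<forall>\<^sub>F n in sequentially. ereal \<beta> \<le> ereal (ln (real (partial_quotients x n)) / ln (real n))"
    using eventually_ge_at_top[of 2]
  proof eventually_elim
    case (elim n)
    have "\<beta> * ln (real n) = ln (real n powr \<beta>)" using elim by (simp add: ln_powr)
    also have "\<dots> \<le> ln (real (partial_quotients x n))" using elim by (intro ln_mono) auto
    finally show ?case using elim by (simp add: pos_le_divide_eq)
  qed
  then have "ereal \<beta> \<le> liminf (\<lambda>n. ereal (ln (real (partial_quotients x n)) / ln (real n)))"
    by (rule Liminf_bounded)
  then show False using x \<beta> by (simp add: E_set_def)
qed

lemma E_set_eventually_ge:
  assumes x: "x \<in> E_set \<alpha>" and \<gamma>: "\<gamma> < \<alpha>"
  shows "\<forall>\<^sub>F n in sequentially. real n powr \<gamma> \<le> real (partial_quotients x n)"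
proof -
  have "ereal \<gamma> < liminf (\<lambda>n. ereal (ln (real (partial_quotients x n)) / ln (real n)))"
    using x \<gamma> by (simp add: E_set_def)
  from less_LiminfD[OF this] show ?thesis
    using eventually_ge_at_top[of 2]
  proof eventually_elim
    case (elim n)
    then have "partial_quotients x n \<ge> 1"
      using x E_set_subset_Lambda_set by (intro Lambda_set_partial_quotients_ge_1) auto
    moreover have "\<gamma> * ln (real n) \<le> ln (real (partial_quotients x n))"
      using elim by (simp add: pos_less_divide_eq)
    ultimately show ?case using elim by (simp add: powr_def ln_ge_iff)
  qed
qed

lemma power_powr:
  fixes x :: real
  assumes "x > 0" shows "(x ^ n) powr a = (x powr a) ^ n"
  using assms by (induction n) (auto simp: powr_mult)

text \<open>Infinitely often the first \<open>n\<close> quotients are bounded by \<open>n\<close>,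
  which leaves at most \<open>4 ^ n\<close> words; since the quotients tend to infinity, their
  products outgrow every \<open>M ^ n\<close>.\<close>

lemma E_set_measure_eq_0_if_less_1:
  assumes "\<alpha> < 1" "s > 0"
  shows "hausdorff_measure s (E_set \<alpha>) = 0"
proof -
  \<comment> \<open>The power makes \<open>M powr (- 2 * s)\<close> at most 1/8, which beats the
    count \<open>4 ^ n\<close> and leaves the ratio 1/2; the factor 2 gives M \<ge> 2.\<close>
  define M where "M = 2 * 8 powr (1 / (2 * s))"
  have "(8::real) powr (1 / (2 * s)) \<ge> 8 powr 0" using assms by (intro powr_mono) auto
  then have M: "M \<ge> 2" by (simp add: M_def)
  have Ms: "M powr (- 2 * s) \<le> 1 / 8"
  proof -
    have "M powr (- 2 * s) = 2 powr (- 2 * s) / 8"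
    proof -
      have "1 / (2 * s) * (- 2 * s) = - 1" using assms by simp
      then have "(8 powr (1 / (2 * s))) powr (- 2 * s) = (8::real) powr (- 1)"
        by (simp only: powr_powr)
      then show ?thesis by (simp add: M_def powr_mult)
    qed
    also have "(2::real) powr (- 2 * s) \<le> 2 powr 0" using assms by (intro powr_mono) auto
    finally show ?thesis by simp
  qed
  show ?thesis
  proof (rule hausdorff_measure_slow_growth_eq_0[OF assms(2) E_set_subset_Lambda_set,
        where p = "\<lambda>_. M" and N = "\<lambda>n. n"])
    show "summable (\<lambda>n. real ((n + n) choose n) * (\<Prod>k<n. M) powr (- 2 * s))"
    proof (rule summable_comparison_test'[of "\<lambda>n. (1 / 2 :: real) ^ n" 0])
      fix n
      have "real ((n + n) choose n) \<le> real (2 ^ (n + n))"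
        using binomial_le_pow2[of "n + n" n] by (simp only: of_nat_le_iff)
      then have b: "real ((n + n) choose n) \<le> 4 ^ n"
        by (simp add: power_add power_mult_distrib[symmetric])
      have "(\<Prod>k<n. M) powr (- 2 * s) = (M powr (- 2 * s)) ^ n"
        using M by (simp add: power_powr)
      also have "\<dots> \<le> (1 / 8) ^ n" using Ms by (intro power_mono) auto
      finally have "real ((n + n) choose n) * (\<Prod>k<n. M) powr (- 2 * s) \<le> 4 ^ n * (1 / 8) ^ n"
        using b by (intro mult_mono) auto
      also have "\<dots> = (1 / 2) ^ n" by (simp add: power_mult_distrib[symmetric])
      finally show "norm (real ((n + n) choose n) * (\<Prod>k<n. M) powr (- 2 * s)) \<le> (1 / 2) ^ n"
        by simp
    qed (simp add: summable_geometric)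
    show "\<exists>\<^sub>F n in sequentially. partial_quotients x n \<le> n" if "x \<in> E_set \<alpha>" for x
      using E_set_frequently_le[OF that assms(1)] by simp
    show "\<forall>\<^sub>F k in sequentially. 2 * M \<le> real (partial_quotients x (Suc k))" if "x \<in> E_set \<alpha>" for x
    proof -
      have "filterlim (partial_quotients x) at_top sequentially"
        using that by (simp add: E_set_def Lambda_set_def)
      then have "filterlim (\<lambda>k. real (partial_quotients x (Suc k))) at_top sequentially"
        by (intro filterlim_compose[OF filterlim_real_sequentially]
            filterlim_compose[OF _ filterlim_Suc])
      then show ?thesis by (simp add: filterlim_at_top)
    qed
  qed (use M in auto)
qed

lemma prod_Suc_powr: "(\<Prod>k<n. real (Suc k) powr \<gamma>) = fact n powr \<gamma>"
  by (induction n) (auto simp: powr_mult mult.commute)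

text \<open>Divided by \<open>fact n\<close>, the left side is a single term of the exponential
  series at \<open>n\<close>. Powers of \<open>n\<close> are thus traded for factorials at the cost
  of an exponential factor.\<close>

lemma power_self_le_exp_fact: "real n ^ n \<le> exp (real n) * fact n"
proof -
  have "real n ^ n / fact n \<le> exp (real n)"
  proof -
    have "(\<Sum>k\<in>{n}. real n ^ k / fact k) \<le> (\<Sum>k. real n ^ k / fact k)"
      using summable_exp[of "real n"] by (intro sum_le_suminf) (auto simp: divide_inverse mult.commute)
    also have "\<dots> = exp (real n)" by (simp add: exp_def divide_inverse scaleR_conv_of_real mult.commute)
    finally show ?thesis by simp
  qed
  then show ?thesis by (simp add: divide_le_eq)
qed

text \<open>The ratio of successive terms is \<open>q * real (Suc n) powr (- \<eta>)\<close>, which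
  tends to 0.\<close>

lemma summable_power_div_fact_powr:
  assumes "q > 0" "\<eta> > 0"
  shows "summable (\<lambda>n. q ^ n * fact n powr (- \<eta>) :: real)"
proof -
  have "(\<lambda>n. q * real (Suc n) powr (- \<eta>)) \<longlonglongrightarrow> 0" using assms by real_asymp
  then have "\<forall>\<^sub>F n in sequentially. q * real (Suc n) powr (- \<eta>) < 1 / 2"
    by (rule order_tendstoD) simp
  then obtain K where K: "\<And>n. n \<ge> K \<Longrightarrow> q * real (Suc n) powr (- \<eta>) < 1 / 2"
    by (auto simp: eventually_sequentially)
  show ?thesis
  proof (rule summable_ratio_test[of "1 / 2" K])
    fix n assume "n \<ge> K"
    have "q ^ Suc n * fact (Suc n) powr (- \<eta>) =
        (q * real (Suc n) powr (- \<eta>)) * (q ^ n * fact n powr (- \<eta>))"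
      by (simp add: powr_mult mult_ac)
    also have "\<dots> \<le> 1 / 2 * (q ^ n * fact n powr (- \<eta>))"
      using K[OF \<open>n \<ge> K\<close>] assms by (intro mult_right_mono) auto
    finally show "norm (q ^ Suc n * fact (Suc n) powr (- \<eta>)) \<le> 1 / 2 * norm (q ^ n * fact n powr (- \<eta>))"
      using assms by (simp add: abs_mult)
  qed simp
qed

lemma E_set_measure_eq_0_if_ge_1:
  assumes \<alpha>: "\<alpha> \<ge> 1" and s: "s > (\<alpha> - 1) / (2 * \<alpha>)"
  shows "hausdorff_measure s (E_set \<alpha>) = 0"
proof -
  have s0: "s > 0" using assms by (smt (verit) divide_nonneg_pos)
  \<comment> \<open>The assumption on \<open>s\<close> leaves room for \<gamma> below \<alpha>; that
    choice in turn leaves room for \<beta> above \<alpha> with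
    \<open>\<beta> - 1 < 2 * s * \<gamma>\<close>, the inequality that makes \<eta>
    positive.\<close>
  have "(\<alpha> - 1) / (2 * s) < \<alpha>" using \<alpha> s s0 by (simp add: field_simps)
  then obtain \<gamma> where \<gamma>: "(\<alpha> - 1) / (2 * s) < \<gamma>" "\<gamma> < \<alpha>" using dense by blast
  have \<gamma>0: "\<gamma> > 0" using \<gamma> \<alpha> s0 by (smt (verit) divide_nonneg_pos)
  \<comment> \<open>The gap between \<gamma> and \<open>\<gamma>'\<close> supplies the factor 2
    demanded by the covering lemma.\<close>
  obtain \<gamma>' where \<gamma>': "\<gamma> < \<gamma>'" "\<gamma>' < \<alpha>" using \<gamma> dense by blast
  have "\<alpha> < 1 + 2 * s * \<gamma>" using \<gamma> s0 by (simp add: pos_divide_less_eq mult.commute)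
  then obtain \<beta> where \<beta>: "\<alpha> < \<beta>" "\<beta> < 1 + 2 * s * \<gamma>" using dense by blast
  define N where "N n = nat \<lfloor>real n powr \<beta>\<rfloor>" for n
  define \<eta> where "\<eta> = 1 + 2 * s * \<gamma> - \<beta>"
  show ?thesis
  proof (rule hausdorff_measure_slow_growth_eq_0[OF s0 E_set_subset_Lambda_set,
        where p = "\<lambda>k. real (Suc k) powr \<gamma>" and N = N])
    show "\<forall>\<^sub>F k in sequentially. 2 \<le> real (Suc k) powr \<gamma>"
      using \<gamma>0 by real_asymp
    show "summable (\<lambda>n. real ((N n + n) choose n) * (\<Prod>k<n. real (Suc k) powr \<gamma>) powr (- 2 * s))"
    proof (rule summable_comparison_test'[of "\<lambda>n. (2 * exp \<beta>) ^ n * fact n powr (- \<eta>)" 1])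
      show "summable (\<lambda>n. (2 * exp \<beta>) ^ n * fact n powr (- \<eta>) :: real)"
        using \<beta> by (intro summable_power_div_fact_powr) (auto simp: \<eta>_def)
      fix n :: nat assume n: "n \<ge> 1"
      have "real n powr 1 \<le> real n powr \<beta>" using n \<alpha> \<beta> by (intro powr_mono) auto
      moreover have "real (N n) \<le> real n powr \<beta>" by (simp add: N_def)
      ultimately have Nn: "real (N n + n) \<le> 2 * real n powr \<beta>" by simp
      \<comment> \<open>This product is a falling factorial: \<open>n\<close> factors, each at most
        \<open>N n + n\<close>.\<close>
      have "real ((N n + n) choose n) * fact n = real (((N n + n) choose n) * fact n)" by simp
      also have "\<dots> \<le> real ((N n + n) ^ n)" using binomial_fact_pow by (simp only: of_nat_le_iff)
      also have "\<dots> \<le> (2 * real n powr \<beta>) ^ n" unfolding of_nat_power by (rule power_mono) (use Nn in auto)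
      also have "\<dots> = 2 ^ n * (real n ^ n) powr \<beta>"
        using n by (simp add: power_mult_distrib power_powr)
      also have "\<dots> \<le> 2 ^ n * (exp (real n) * fact n) powr \<beta>"
        using \<alpha> \<beta> power_self_le_exp_fact by (intro mult_left_mono powr_mono2) auto
      also have "\<dots> = (2 * exp \<beta>) ^ n * fact n powr \<beta>"
        by (simp add: powr_mult power_mult_distrib exp_powr_real exp_of_nat_mult[symmetric])
      finally have "real ((N n + n) choose n) \<le> (2 * exp \<beta>) ^ n * (fact n powr \<beta> / fact n)"
        by (simp add: pos_le_divide_eq)
      then have "real ((N n + n) choose n) * (fact n powr \<gamma>) powr (- 2 * s)
          \<le> (2 * exp \<beta>) ^ n * (fact n powr \<beta> / fact n) * (fact n powr \<gamma>) powr (- 2 * s)"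
        by (rule mult_right_mono) simp
      also have "\<dots> = (2 * exp \<beta>) ^ n * (fact n powr \<beta> * fact n powr (- 1) * fact n powr (- (2 * s * \<gamma>)))"
        by (simp add: powr_powr powr_minus divide_inverse mult_ac)
      also have "\<dots> = (2 * exp \<beta>) ^ n * fact n powr (- \<eta>)"
        unfolding powr_add[symmetric] \<eta>_def by (simp add: algebra_simps)
      finally show "norm (real ((N n + n) choose n) * (\<Prod>k<n. real (Suc k) powr \<gamma>) powr (- 2 * s))
          \<le> (2 * exp \<beta>) ^ n * fact n powr (- \<eta>)"
        unfolding prod_Suc_powr by simp
    qed
    fix x assume x: "x \<in> E_set \<alpha>"
    show "\<exists>\<^sub>F n in sequentially. partial_quotients x n \<le> N n"
      using E_set_frequently_le[OF x \<beta>(1)] unfolding N_def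
      by (rule frequently_elim1) (simp add: le_nat_iff le_floor_iff)
    have "\<forall>\<^sub>F k in sequentially. real (Suc k) powr \<gamma>' \<le> real (partial_quotients x (Suc k))"
      using E_set_eventually_ge[OF x \<gamma>'(2)] by (rule eventually_sequentially_Suc[THEN iffD2])
    moreover have "\<forall>\<^sub>F k in sequentially. 2 * real (Suc k) powr \<gamma> \<le> real (Suc k) powr \<gamma>'"
      using \<gamma>' \<gamma>0 by real_asymp
    ultimately show "\<forall>\<^sub>F k in sequentially. 2 * real (Suc k) powr \<gamma> \<le> real (partial_quotients x (Suc k))"
      by eventually_elim linarith
  qed auto
qed

section \<open>Mixed radix expansions\<close>

text \<open>Remainders of the Cantor series expansion of \<open>t\<close> with bases
  \<open>m 0\<close>, \<open>m 1\<close>, and so on; the integer parts dropped by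
  \<open>frac\<close> are its digits.\<close>

primrec radix_rem :: "(nat \<Rightarrow> nat) \<Rightarrow> real \<Rightarrow> nat \<Rightarrow> real" where
  "radix_rem m t 0 = t"
| "radix_rem m t (Suc k) = frac (real (m k) * radix_rem m t k)"

definition radix_digit :: "(nat \<Rightarrow> nat) \<Rightarrow> real \<Rightarrow> nat \<Rightarrow> nat" where
  "radix_digit m t k = nat \<lfloor>real (m k) * radix_rem m t k\<rfloor>"

lemma radix_rem_range:
  assumes "t \<in> {0..<1}" shows "radix_rem m t k \<in> {0..<1}"
  using assms by (cases k) (auto simp: frac_lt_1)

lemma radix_digit_less:
  assumes "t \<in> {0..<1}" "m k \<ge> 1" shows "radix_digit m t k < m k"
proof -
  have "real (m k) * radix_rem m t k < real (m k)"
    using radix_rem_range[OF assms(1), of m k] assms(2) by simp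
  then show ?thesis
    using radix_rem_range[OF assms(1), of m k] assms(2)
    by (simp add: radix_digit_def nat_less_iff floor_less_iff)
qed

text \<open>As long as the digits agree, the same integer is subtracted from both remainders, so
  each step only multiplies their difference by \<open>m k\<close>.\<close>

lemma radix_rem_diff:
  assumes t: "t \<in> {0..<1}" "t' \<in> {0..<1}"
    and eq: "\<And>k. k < n \<Longrightarrow> radix_digit m t k = radix_digit m t' k"
  shows "radix_rem m t n - radix_rem m t' n = (\<Prod>k<n. real (m k)) * (t - t')"
  using eq
proof (induction n)
  case (Suc n)
  have "nat \<lfloor>real (m n) * radix_rem m t n\<rfloor> = nat \<lfloor>real (m n) * radix_rem m t' n\<rfloor>"
    using Suc.prems[of n] by (simp add: radix_digit_def)
  \<comment> \<open>\<open>nat\<close> is injective only on nonnegative integers, so the signs are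
    needed to pass from equal digits to equal floors.\<close>
  moreover have "0 \<le> \<lfloor>real (m n) * radix_rem m t n\<rfloor>" "0 \<le> \<lfloor>real (m n) * radix_rem m t' n\<rfloor>"
    using radix_rem_range[OF t(1), of m n] radix_rem_range[OF t(2), of m n] by auto
  ultimately have "\<lfloor>real (m n) * radix_rem m t n\<rfloor> = \<lfloor>real (m n) * radix_rem m t' n\<rfloor>"
    by linarith
  then have "radix_rem m t (Suc n) - radix_rem m t' (Suc n) =
      real (m n) * (radix_rem m t n - radix_rem m t' n)"
    by (simp add: frac_def algebra_simps)
  then show ?case using Suc by simp
qed simp

lemma radix_digits_agree_imp_close:
  assumes t: "t \<in> {0..<1}" "t' \<in> {0..<1}"
    and eq: "\<And>k. k < n \<Longrightarrow> radix_digit m t k = radix_digit m t' k"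
  shows "(\<Prod>k<n. real (m k)) * \<bar>t - t'\<bar> \<le> 1"
proof -
  have "(\<Prod>k<n. real (m k)) * \<bar>t - t'\<bar> = \<bar>radix_rem m t n - radix_rem m t' n\<bar>"
    using radix_rem_diff[of t t' n m] t eq by (simp add: abs_mult abs_prod)
  also have "\<dots> \<le> 1"
    using radix_rem_range[OF t(1), of m n] radix_rem_range[OF t(2), of m n] by auto
  finally show ?thesis .
qed

section \<open>The lower bound\<close>

text \<open>Factor out \<open>x powr (\<alpha> - 1)\<close> and enlarge its base. Consecutive
  \<alpha>-th powers thus leave room for the choices of a digit.\<close>

lemma powr_add_one_ge:
  fixes x :: real
  assumes "x > 0" "\<alpha> \<ge> 1"
  shows "(x + 1) powr \<alpha> \<ge> x powr \<alpha> + x powr (\<alpha> - 1)"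
proof -
  have "x powr \<alpha> + x powr (\<alpha> - 1) = (x + 1) * x powr (\<alpha> - 1)"
    using assms powr_add[of x 1 "\<alpha> - 1"] by (simp add: algebra_simps)
  also have "\<dots> \<le> (x + 1) * (x + 1) powr (\<alpha> - 1)"
    using assms by (intro mult_left_mono powr_mono2) auto
  also have "\<dots> = (x + 1) powr \<alpha>"
    using assms powr_add[of "x + 1" 1 "\<alpha> - 1"] by simp
  finally show ?thesis .
qed

text \<open>The upper bound for \<open>b k\<close> is the lower bound for \<open>b (Suc k)\<close>,
  hence monotonicity. Both bounds have logarithms asymptotic to \<open>\<alpha> * ln k\<close>, so
  the lower limit is even a limit.\<close>

lemma cf_lim_in_E_set:
  assumes \<alpha>: "\<alpha> > 0"
    and lo: "\<And>k. real (k + 1) powr \<alpha> \<le> real (b k)"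
    and hi: "\<And>k. real (b k) \<le> real (k + 2) powr \<alpha>"
  shows "cf_lim b \<in> E_set \<alpha>"
proof -
  have b1: "b k \<ge> 1" for k
  proof -
    have "1 \<le> real (k + 1) powr \<alpha>" using \<alpha> by (intro ge_one_powr_ge_zero) auto
    then show ?thesis using lo[of k] by linarith
  qed
  have "b k \<le> b (Suc k)" for k
    using hi[of k] lo[of "Suc k"] by (simp add: add.commute)
  then have "mono b" by (simp add: mono_iff_le_Suc)
  have pq: "partial_quotients (cf_lim b) (Suc n) = b n" for n
    by (rule partial_quotients_cf_lim[OF b1])
  have "mono_on {1..} (partial_quotients (cf_lim b))"
  proof (rule mono_onI)
    fix r s :: nat assume "r \<in> {1..}" "r \<le> s"
    then show "partial_quotients (cf_lim b) r \<le> partial_quotients (cf_lim b) s"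
      using pq[of "r - 1"] pq[of "s - 1"] monoD[OF \<open>mono b\<close>, of "r - 1" "s - 1"] by simp
  qed
  moreover have "filterlim (partial_quotients (cf_lim b)) at_top sequentially"
  proof -
    have "filterlim (\<lambda>k. real (k + 1) powr \<alpha>) at_top sequentially" using \<alpha> by real_asymp
    then have "filterlim (\<lambda>k. real (b k)) at_top sequentially"
      by (rule filterlim_at_top_mono) (use lo in auto)
    then have "filterlim b at_top sequentially"
      by (simp add: filterlim_sequentially_iff_filterlim_real)
    then have "filterlim (\<lambda>n. partial_quotients (cf_lim b) (Suc n)) at_top sequentially"
      by (simp add: pq)
    then show ?thesis by (simp add: filterlim_sequentially_Suc)
  qed
  moreover have "cf_lim b \<in> {0..<1}" "cf_lim b \<notin> \<rat>"
    using cf_lim_gt_0[of b, OF b1] cf_lim_lt_1[of b, OF b1] cf_lim_irrational[of b, OF b1] by auto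
  ultimately have \<Lambda>: "cf_lim b \<in> Lambda_set" by (simp add: Lambda_set_def)
  have "(\<lambda>n. ln (real (b n)) / ln (real (Suc n))) \<longlonglongrightarrow> \<alpha>"
  proof (rule tendsto_sandwich)
    show "(\<lambda>n. \<alpha> * ln (real (n + 1)) / ln (real (Suc n))) \<longlonglongrightarrow> \<alpha>" by real_asymp
    show "(\<lambda>n. \<alpha> * ln (real (n + 2)) / ln (real (Suc n))) \<longlonglongrightarrow> \<alpha>" by real_asymp
    have lnb: "\<alpha> * ln (real (n + 1)) \<le> ln (real (b n))" "ln (real (b n)) \<le> \<alpha> * ln (real (n + 2))" for n
    proof -
      have "\<alpha> * ln (real (n + 1)) = ln (real (n + 1) powr \<alpha>)" by (simp add: ln_powr)
      also have "\<dots> \<le> ln (real (b n))" using lo[of n] by (intro ln_mono) auto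
      finally show "\<alpha> * ln (real (n + 1)) \<le> ln (real (b n))" .
      have "ln (real (b n)) \<le> ln (real (n + 2) powr \<alpha>)"
        using hi[of n] b1[of n] by (intro ln_mono) auto
      then show "ln (real (b n)) \<le> \<alpha> * ln (real (n + 2))" by (simp add: ln_powr)
    qed
    show "\<forall>\<^sub>F n in sequentially. \<alpha> * ln (real (n + 1)) / ln (real (Suc n)) \<le> ln (real (b n)) / ln (real (Suc n))"
      "\<forall>\<^sub>F n in sequentially. ln (real (b n)) / ln (real (Suc n)) \<le> \<alpha> * ln (real (n + 2)) / ln (real (Suc n))"
      by (intro always_eventually allI divide_right_mono lnb; simp)+
  qed
  then have "(\<lambda>n. ln (real (partial_quotients (cf_lim b) (Suc n))) / ln (real (Suc n))) \<longlonglongrightarrow> \<alpha>"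
    by (simp add: pq)
  then have "(\<lambda>n. ln (real (partial_quotients (cf_lim b) n)) / ln (real n)) \<longlonglongrightarrow> \<alpha>"
    by (rule LIMSEQ_imp_Suc)
  then have "liminf (\<lambda>n. ereal (ln (real (partial_quotients (cf_lim b) n)) / ln (real n))) = ereal \<alpha>"
    by (intro lim_imp_Liminf) auto
  then show ?thesis using \<Lambda> by (simp add: E_set_def)
qed

text \<open>If the digits of \<open>t\<close> and \<open>t'\<close> first differ at
  \<open>n\<close>, then their distance is at most the inverse of the product of the first
  \<open>n\<close> bases, while the images are at least \<open>\<rho> n\<close> apart. The estimate
  therefore holds with \<open>C = 1 / c\<close> for any positive lower bound \<open>c\<close> of
  \<open>f\<close>.\<close>

lemma E_set_inverse_Hoelder:
  assumes \<alpha>: "\<alpha> > 1" and s: "0 < s" "s < (\<alpha> - 1) / (2 * \<alpha>)"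
  obtains h C where "C > 0" "h ` {0..<1} \<subseteq> E_set \<alpha>"
    "\<And>t t'. t \<in> {0..<1} \<Longrightarrow> t' \<in> {0..<1} \<Longrightarrow> \<bar>t - t'\<bar> \<le> C * dist (h t) (h t') powr s"
proof -
  define u where "u k = nat \<lceil>real (k + 1) powr \<alpha>\<rceil>" for k
  define m where "m k = nat \<lfloor>real (k + 1) powr (\<alpha> - 1)\<rfloor>" for k
  define b where "b t k = u k + radix_digit m t k" for t k
  \<comment> \<open>The shift to \<open>k + 3\<close> makes room for the summand 1 in the separation
    lemma, as \<open>b t k\<close> may come up to \<open>real (k + 2) powr \<alpha>\<close>.\<close>
  define v where "v k = real (k + 3) powr \<alpha>" for k
  have x1: "real (k + 1) powr (\<alpha> - 1) \<ge> 1" for k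
    using \<alpha> by (intro ge_one_powr_ge_zero) auto
  then have m1: "m k \<ge> 1" for k by (simp add: m_def le_nat_iff)
  have m_half: "real (m k) \<ge> real (k + 1) powr (\<alpha> - 1) / 2" for k
  proof -
    have "\<lfloor>real (k + 1) powr (\<alpha> - 1)\<rfloor> \<ge> 1" using x1[of k] by simp
    then show ?thesis unfolding m_def by linarith
  qed
  have lo: "real (k + 1) powr \<alpha> \<le> real (b t k)" for t k
  proof -
    have "real (k + 1) powr \<alpha> \<le> real (u k)" unfolding u_def by linarith
    then show ?thesis by (simp add: b_def)
  qed
  have hi: "real (b t k) \<le> real (k + 2) powr \<alpha>" if "t \<in> {0..<1}" for t k
  proof -
    \<comment> \<open>Rounding up costs at most 1, which is regained because the digit is at most
      \<open>m k - 1\<close>.\<close>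
    have "real (u k) \<le> real (k + 1) powr \<alpha> + 1"
      unfolding u_def by (smt (verit) of_int_ceiling_le_add_one of_nat_nat powr_ge_zero zero_le_ceiling)
    moreover have "real (radix_digit m t k) \<le> real (m k) - 1"
      using radix_digit_less[OF that, of m k] m1[of k] by linarith
    moreover have "real (m k) \<le> real (k + 1) powr (\<alpha> - 1)" by (simp add: m_def)
    moreover have "real (k + 1) powr \<alpha> + real (k + 1) powr (\<alpha> - 1) \<le> real (k + 2) powr \<alpha>"
      using powr_add_one_ge[of "real (k + 1)" \<alpha>] \<alpha> by (simp add: add_ac)
    ultimately show ?thesis by (simp add: b_def)
  qed
  have bv: "real (b t k) + 1 \<le> v k" if "t \<in> {0..<1}" for t k
  proof -
    have "1 \<le> real (k + 2) powr (\<alpha> - 1)" using \<alpha> by (intro ge_one_powr_ge_zero) auto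
    then show ?thesis
      using hi[OF that, of k] powr_add_one_ge[of "real (k + 2)" \<alpha>] \<alpha> by (simp add: v_def add_ac)
  qed
  have b1: "b t k \<ge> 1" for t k
  proof -
    have "1 \<le> real (k + 1) powr \<alpha>" using \<alpha> by (intro ge_one_powr_ge_zero) auto
    then show ?thesis using lo[of k t] by linarith
  qed
  have b2: "b t (Suc k) \<ge> 2" for t k
  proof -
    have "2 \<le> real (Suc k + 1) powr 1" by simp
    also have "\<dots> \<le> real (Suc k + 1) powr \<alpha>" using \<alpha> by (intro powr_mono) auto
    finally show ?thesis using lo[of "Suc k" t] by linarith
  qed
  have m0: "(\<Prod>k<n. real (m k)) > 0" for n
    using m1 by (intro prod_pos) (auto simp: Suc_le_eq)
  have m_top: "filterlim (\<lambda>n. \<Prod>k<n. real (m k)) at_top sequentially"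
  proof (rule doubling_imp_at_top[OF m0])
    have "\<forall>\<^sub>F n in sequentially. 2 \<le> real (n + 1) powr (\<alpha> - 1) / 2"
      using \<alpha> by real_asymp
    then show "\<forall>\<^sub>F n in sequentially. 2 * (\<Prod>k<n. real (m k)) \<le> (\<Prod>k<Suc n. real (m k))"
    proof eventually_elim
      case (elim n)
      then have "2 \<le> real (m n)" using m_half[of n] by linarith
      then show ?case using m0[of n] by (simp add: mult.commute)
    qed
  qed
  define \<rho> where "\<rho> n = 1 / (2 * (\<Prod>k\<le>n. v k)\<^sup>2)" for n
  have v0: "v k > 0" for k by (simp add: v_def)
  have \<rho>0: "\<rho> n > 0" for n unfolding \<rho>_def
    by (intro divide_pos_pos mult_pos_pos zero_less_power prod_pos) (auto simp: v0)
  \<comment> \<open>Only the \<open>n\<close> digits below \<open>n\<close> agree, so the bases are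
    multiplied over \<open>k < n\<close>, whereas \<open>\<rho> n\<close> also involves index
    \<open>n\<close>, where the quotients differ.\<close>
  define f where "f n = (\<Prod>k<n. real (m k)) * \<rho> n powr s" for n
  have f0: "f n > 0" for n unfolding f_def using m0[of n] \<rho>0[of n] by simp
  have f_top: "filterlim f at_top sequentially"
  proof (rule doubling_imp_at_top[OF f0])
    \<comment> \<open>Growth exponent of \<open>f (Suc n) / f n\<close>: \<open>m n\<close>
      contributes \<open>\<alpha> - 1\<close> and \<open>v (Suc n) powr (- 2 * s)\<close>
      contributes \<open>- 2 * s * \<alpha>\<close>. It is positive exactly when \<open>s\<close> is
      below the claimed dimension.\<close>
    define e where "e = \<alpha> - 1 - 2 * s * \<alpha>"
    have e: "e > 0" using s \<alpha> by (simp add: e_def field_simps)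
    \<comment> \<open>A lower bound for \<open>f (Suc n) / f n\<close>: the half comes from the
      floor in \<open>m n\<close>, and \<open>n + 4\<close> from \<open>v (Suc n)\<close>.\<close>
    have "filterlim (\<lambda>n. real (n + 1) powr e * ((real (n + 1) / real (n + 4)) powr (2 * s * \<alpha>) / 2))
        at_top sequentially"
      using e by real_asymp
    then have "\<forall>\<^sub>F n in sequentially.
        2 \<le> real (n + 1) powr e * ((real (n + 1) / real (n + 4)) powr (2 * s * \<alpha>) / 2)"
      by (rule filterlim_at_top[THEN iffD1, rule_format])
    then show "\<forall>\<^sub>F n in sequentially. 2 * f n \<le> f (Suc n)"
    proof eventually_elim
      case (elim n)
      have "\<rho> (Suc n) = \<rho> n * v (Suc n) powr (- 2)"
        unfolding powr_neg_numeral[OF v0] by (simp add: \<rho>_def power_mult_distrib)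
      then have f_Suc: "f (Suc n) = (real (m n) * v (Suc n) powr (- 2 * s)) * f n"
        by (simp add: f_def powr_mult powr_powr)
      have split: "x powr e * ((x / y) powr d / 2) = x powr (e + d) / 2 * y powr (- d)"
        if "x > 0" "y > 0" for x y d :: real
      proof -
        have "(x / y) powr d = x powr d / y powr d" by (rule powr_divide)
        then show ?thesis by (simp only: powr_add powr_minus_divide) simp
      qed
      have "2 \<le> real (n + 1) powr (e + 2 * s * \<alpha>) / 2 * real (n + 4) powr (- (2 * s * \<alpha>))"
        using elim split[of "real (n + 1)" "real (n + 4)" "2 * s * \<alpha>"] by simp
      also have "\<dots> = real (n + 1) powr (\<alpha> - 1) / 2 * real (n + 4) powr (\<alpha> * (- 2 * s))"
        by (simp add: e_def mult.commute)
      also have "\<dots> = real (n + 1) powr (\<alpha> - 1) / 2 * v (Suc n) powr (- 2 * s)"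
        by (simp only: v_def powr_powr) (simp add: add.commute)
      also have "\<dots> \<le> real (m n) * v (Suc n) powr (- 2 * s)"
        using m_half[of n] by (intro mult_right_mono) auto
      finally show ?case unfolding f_Suc using f0[of n] by (intro mult_right_mono) auto
    qed
  qed
  obtain c where c: "c > 0" "\<And>n. f n \<ge> c"
    using pos_at_top_imp_bounded_below[OF f0 f_top] by blast
  define h where "h t = cf_lim (b t)" for t
  have "h ` {0..<1} \<subseteq> E_set \<alpha>"
    unfolding h_def using cf_lim_in_E_set[of \<alpha>] lo hi \<alpha> by auto
  moreover have "\<bar>t - t'\<bar> \<le> (1 / c) * dist (h t) (h t') powr s"
    if t: "t \<in> {0..<1}" "t' \<in> {0..<1}" for t t'
  proof (cases "t = t'")
    case False
    \<comment> \<open>If all digits agreed, the products of the bases would stay below the inverse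
      of the distance of \<open>t\<close> and \<open>t'\<close>, although they tend to
      infinity.\<close>
    have "\<exists>k. radix_digit m t k \<noteq> radix_digit m t' k"
    proof (rule ccontr)
      assume "\<not> ?thesis"
      then have bound: "(\<Prod>k<n. real (m k)) \<le> 1 / \<bar>t - t'\<bar>" for n
        using radix_digits_agree_imp_close[OF t, of n m] False by (simp add: pos_le_divide_eq)
      have "\<forall>\<^sub>F n in sequentially. 1 / \<bar>t - t'\<bar> < (\<Prod>k<n. real (m k))"
        using m_top by (simp add: filterlim_at_top_dense)
      then show False using bound by (auto simp: eventually_sequentially not_less[symmetric])
    qed
    then have ex: "\<exists>k. b t k \<noteq> b t' k" by (simp add: b_def)
    define n where "n = (LEAST k. b t k \<noteq> b t' k)"
    have n: "b t n \<noteq> b t' n" "\<And>k. k < n \<Longrightarrow> b t k = b t' k"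
      unfolding n_def using LeastI_ex[OF ex] not_less_Least by blast+
    have "\<rho> n \<le> dist (h t) (h t')"
      unfolding h_def \<rho>_def dist_real_def
      using n b1 b2 bv t by (intro cf_lim_separation) auto
    then have \<rho>: "\<rho> n powr s \<le> dist (h t) (h t') powr s"
      using \<rho>0[of n] s by (intro powr_mono2) auto
    have "(\<Prod>k<n. real (m k)) * \<bar>t - t'\<bar> \<le> 1"
      using n(2) by (intro radix_digits_agree_imp_close t) (simp add: b_def)
    then have "\<bar>t - t'\<bar> \<le> 1 / (\<Prod>k<n. real (m k))"
      using m0[of n] by (simp add: pos_le_divide_eq mult.commute)
    also have "\<dots> \<le> (1 / c) * \<rho> n powr s"
      using m0[of n] c(1) c(2)[of n] unfolding f_def by (simp add: divide_le_eq pos_le_divide_eq mult_ac)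
    also have "\<dots> \<le> (1 / c) * dist (h t) (h t') powr s"
      using \<rho> c by (intro mult_left_mono) auto
    finally show ?thesis .
  qed simp
  ultimately show thesis using that[of "1 / c" h] c(1) by simp
qed

lemma E_set_measure_neq_0:
  assumes \<alpha>: "\<alpha> > 1" and s: "0 \<le> s" "s < (\<alpha> - 1) / (2 * \<alpha>)"
  shows "hausdorff_measure s (E_set \<alpha>) \<noteq> 0"
proof -
  obtain s' where s': "s < s'" "s' < (\<alpha> - 1) / (2 * \<alpha>)" using s dense by blast
  show ?thesis
  proof (cases "s = 0")
    case True
    \<comment> \<open>At exponent 0 one point of the set suffices; the map for the positive exponent
      \<open>s'\<close> provides it.\<close>
    obtain h C where h: "C > 0" "h ` {0..<1} \<subseteq> E_set \<alpha>"
      "\<And>t t'. t \<in> {0..<1} \<Longrightarrow> t' \<in> {0..<1} \<Longrightarrow> \<bar>t - t'\<bar> \<le> C * dist (h t) (h t') powr s'"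
      by (rule E_set_inverse_Hoelder[OF \<alpha> _ s'(2)]) (use s s' in auto)
    have "h 0 \<in> E_set \<alpha>" using h(2) by auto
    then show ?thesis using True hausdorff_measure_zero_nonempty by blast
  next
    case False
    obtain h C where h: "C > 0" "h ` {0..<1} \<subseteq> E_set \<alpha>"
      "\<And>t t'. t \<in> {0..<1} \<Longrightarrow> t' \<in> {0..<1} \<Longrightarrow> \<bar>t - t'\<bar> \<le> C * dist (h t) (h t') powr s"
      by (rule E_set_inverse_Hoelder[OF \<alpha> _ s(2)]) (use s False in auto)
    show ?thesis
      by (rule hausdorff_measure_nonzero_if_inverse_Hoelder[OF _ h]) (use False s in auto)
  qed
qed

theorem theorem2p5:
  fixes \<alpha> :: real
  assumes "\<alpha> \<ge> 0"
  shows "(\<alpha> < 1 \<longrightarrow> hausdorff_dim (E_set \<alpha>) = 0) \<and>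
         (\<alpha> \<ge> 1 \<longrightarrow> hausdorff_dim (E_set \<alpha>) = ereal ((\<alpha> - 1) / (2 * \<alpha>)))"
proof (intro conjI impI)
  assume "\<alpha> < 1"
  then have "hausdorff_dim (E_set \<alpha>) \<le> ereal 0"
    by (intro hausdorff_dim_le E_set_measure_eq_0_if_less_1) auto
  then show "hausdorff_dim (E_set \<alpha>) = 0"
    using hausdorff_dim_nonneg[of "E_set \<alpha>"] by (simp add: zero_ereal_def)
next
  assume \<alpha>: "\<alpha> \<ge> 1"
  have "hausdorff_dim (E_set \<alpha>) \<le> ereal ((\<alpha> - 1) / (2 * \<alpha>))"
    using \<alpha> by (intro hausdorff_dim_le E_set_measure_eq_0_if_ge_1) auto
  moreover have "ereal ((\<alpha> - 1) / (2 * \<alpha>)) \<le> hausdorff_dim (E_set \<alpha>)"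
  proof (cases "\<alpha> = 1")
    \<comment> \<open>The claimed dimension is 0 at \<alpha> = 1, so nonnegativity is
      enough.\<close>
    case True
    then show ?thesis using hausdorff_dim_nonneg[of "E_set \<alpha>"] by (simp add: zero_ereal_def)
  next
    case False
    then show ?thesis using \<alpha> by (intro hausdorff_dim_ge E_set_measure_neq_0) auto
  qed
  ultimately show "hausdorff_dim (E_set \<alpha>) = ereal ((\<alpha> - 1) / (2 * \<alpha>))" by (rule antisym)
qed

end
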